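(* Let $(a_k)_{k\ge 2}$ be a probability distribution on the integers $\{2,3,\dots\}$ with generating function $G(s)=\sum_{k=2}^\infty a_k s^k$. Consider the random tree with a distinguished vertex $0$ whose vertex degrees $D_i$ are i.i.d. with $\mathbb{Q}(D_i=k)=a_k$, and on it the parking process (blocking random sequential adsorption) $n(t)=(n_i(t))_{i\in V}$ with rate-one arrivals at every vertex, started from the empty configuration $n_i(0)=0$ for all $i\in V$. Then for every $t\ge 0$ the occupation probability of vertex $0$, averaged over the dynamics ($\mathbb{E}$) and over the random tree ($\mathbb{Q}$), is $$\mathbb{Q}\,\mathbb{E}\bigl(n_0(t)\bigr)=\frac{1-\bigl(\alpha(1-e^{-t})\bigr)^2}{2},$$ where the function $\alpha(u)\in(0,1]$ is defined by the equation $$\int_{\alpha(u)}^1\frac{x\,dx}{G(x)}=u .$$ In particular, $$\lim_{t\to\infty}\mathbb{Q}\,\mathbb{E}\bigl(n_0(t)\bigr)=\frac{1-\alpha^2}{2},\qquad\text{where }\alpha\in(0,1)\text{ is determined by }\int_{\alpha}^1\frac{x\,dx}{G(x)}=1 .$$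
   Context: Random tree: an infinite tree with vertex set $V$ and a distinguished vertex $0\in V$, in which the degrees $D_i$ of the vertices $i$ are independent random variables, all with the same distribution $\mathbb{Q}(D_i=k)=a_k$, $k\ge 2$. Equivalently, vertex $0$ has $D_0$ neighbors, and each other vertex $i$ has, besides its neighbor on the path to $0$, exactly $D_i-1$ further neighbors. The symbol $\mathbb{Q}$ denotes both the law of the random tree and the expectation with respect to it. The tree is chosen once and is unchanged by the dynamics. Write $d$ for the graph distance on the tree. Dynamics: for a fixed realization of the tree, the parking process is the Markov jump process on $\Omega=\{0,1\}^V$, where $n_i=1$ means that vertex $i$ is occupied and $n_i=0$ that it is vacant, determined by $$\frac{d}{dt}\mathbb{E}^{n} f(n(t))=\mathbb{E}^{n}\Bigl(\sum_{k\in V}\bigl[f(n(t)^k)-f(n(t))\bigr]\,r_k(n(t))\Bigr)$$ for every local function $f:\Omega\to\mathbb{R}$ (that is, $f$ depends on finitely many coordinates). Here $n^k$ is the configuration with $n^k_i=n_i$ for $i\neq k$ and $n^k_k=1$, and $$r_k(n)=\prod_{i:\,d(i,k)\le 1}(1-n_i).$$ Thus at each vertex $k$ a particle (car) arrives after an exponential waiting time $T_k$ of mean one, independently over the vertices, and it sticks permanently to $k$ if and only if $k$ and all of its nearest neighbors are vacant at that time; otherwise it is rejected. Only the first arrival at each vertex matters. $\mathbb{E}^n$ denotes expectation for the process started at the configuration $n$, on a fixed tree, and $\mathbb{E}$ denotes this expectation for the process started from the empty configuration. As a standing convention, this generator is taken to define a Markov jump process on the infinite tree. *)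

theory Defs
  imports "HOL-Probability.Probability" "HOL-Library.Extended_Nat"
begin

section \<open>The random tree\<close>

text \<open>
  Trees are rooted at the distinguished vertex \<open>[]\<close> and coded by Ulam--Harris words: the children
  of the vertex \<open>i\<close> are the words \<open>i @ [0], i @ [1], \<dots>\<close>. A tree is given by a
  family \<open>D\<close> of prescribed degrees; all vertices but the root spend one unit of degree on the
  edge to their parent. Values of \<open>D\<close> at words that are not vertices play no role.
\<close>

definition num_children :: "(nat list \<Rightarrow> nat) \<Rightarrow> nat list \<Rightarrow> nat" where
  "num_children D i = (if i = [] then D i else D i - 1)"

inductive_set tree_vertices :: "(nat list \<Rightarrow> nat) \<Rightarrow> nat list set"
  for D :: "nat list \<Rightarrow> nat" where
  root: "[] \<in> tree_vertices D"
| child: "i \<in> tree_vertices D \<Longrightarrow> x < num_children D i \<Longrightarrow> i @ [x] \<in> tree_vertices D"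

definition tree_edges :: "(nat list \<Rightarrow> nat) \<Rightarrow> (nat list \<times> nat list) set" where
  "tree_edges D = {(i, j). i \<in> tree_vertices D \<and> j \<in> tree_vertices D \<and>
     (\<exists>x. j = i @ [x] \<or> i = j @ [x])}"

lemma snoc_in_tree_vertices_iff:
  "i @ [x] \<in> tree_vertices D \<longleftrightarrow> i \<in> tree_vertices D \<and> x < num_children D i"
  by (auto intro: tree_vertices.child elim: tree_vertices.cases)

lemma degree_tree:
  assumes "i \<in> tree_vertices D" "1 \<le> D i"
  shows "card {j. (i, j) \<in> tree_edges D} = D i"
proof -
  let ?C = "(\<lambda>x. i @ [x]) ` {..<num_children D i}"
  have C: "card ?C = num_children D i"
    by (subst card_image) (auto simp: inj_on_def)
  show ?thesis
  proof (cases i rule: rev_cases)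
    case Nil
    then have "{j. (i, j) \<in> tree_edges D} = ?C"
      using assms(1) by (auto simp: tree_edges_def snoc_in_tree_vertices_iff
          snoc_in_tree_vertices_iff[of "[]", simplified])
    then show ?thesis using C Nil by (simp add: num_children_def)
  next
    case (snoc p y)
    then have "{j. (i, j) \<in> tree_edges D} = insert p ?C"
      using assms(1) by (auto simp: tree_edges_def snoc_in_tree_vertices_iff
          snoc_in_tree_vertices_iff[of "p @ [y]", simplified])
    moreover have "p \<notin> ?C" using snoc by auto
    ultimately show ?thesis using C snoc assms(2) by (simp add: num_children_def)
  qed
qed

text \<open>
  The law \<open>Q\<close> of the tree: the degrees are i.i.d. with distribution \<open>a\<close>. The product
  measure is completed so that quantities that are only determined for almost every tree can be
  averaged over it.
\<close>

definition tree_law :: "nat pmf \<Rightarrow> (nat list \<Rightarrow> nat) measure" where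
  "tree_law a = completion (PiM UNIV (\<lambda>_. measure_pmf a))"


section \<open>The parking process on a fixed graph\<close>

definition graph_dist :: "('v \<times> 'v) set \<Rightarrow> 'v \<Rightarrow> 'v \<Rightarrow> enat" where
  "graph_dist E i k = (INF m \<in> {m. (i, k) \<in> E ^^ m}. enat m)"

definition configs :: "'v set \<Rightarrow> ('v \<Rightarrow> bool) measure" where
  "configs V = PiM V (\<lambda>_. count_space UNIV)"

definition empty_config :: "'v set \<Rightarrow> 'v \<Rightarrow> bool" where
  "empty_config V = (\<lambda>i\<in>V. False)"

definition local_function :: "'v set \<Rightarrow> (('v \<Rightarrow> bool) \<Rightarrow> real) \<Rightarrow> bool" where
  "local_function V f \<longleftrightarrow> (\<exists>A. finite A \<and> A \<subseteq> V \<and>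
     (\<forall>n\<in>space (configs V). \<forall>m\<in>space (configs V). (\<forall>i\<in>A. n i = m i) \<longrightarrow> f n = f m))"

definition parking_rate :: "'v set \<Rightarrow> ('v \<times> 'v) set \<Rightarrow> 'v \<Rightarrow> ('v \<Rightarrow> bool) \<Rightarrow> real" where
  "parking_rate V E k n = (\<Prod>i\<in>{i\<in>V. graph_dist E i k \<le> 1}. 1 - of_bool (n i))"

text \<open>For a local \<open>f\<close> only finitely many terms of the sum are nonzero.\<close>

definition parking_generator ::
  "'v set \<Rightarrow> ('v \<times> 'v) set \<Rightarrow> (('v \<Rightarrow> bool) \<Rightarrow> real) \<Rightarrow> ('v \<Rightarrow> bool) \<Rightarrow> real" where
  "parking_generator V E f n =
     (\<Sum>\<^sub>\<infinity>k\<in>V. (f (n(k := True)) - f n) * parking_rate V E k n)"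

text \<open>
  The Markov process is given by its transition function: \<open>P t n\<close> is the law of the
  configuration at time \<open>t\<close> for the process started at \<open>n\<close>, so that the expectation
  of \<open>f (n(t))\<close> is the integral of \<open>f\<close> with respect to \<open>P t n\<close>.
\<close>

definition parking_process ::
  "'v set \<Rightarrow> ('v \<times> 'v) set \<Rightarrow> (real \<Rightarrow> ('v \<Rightarrow> bool) \<Rightarrow> ('v \<Rightarrow> bool) measure) \<Rightarrow> bool" where
  "parking_process V E P \<longleftrightarrow>
     (\<forall>t\<ge>0. P t \<in> configs V \<rightarrow>\<^sub>M prob_algebra (configs V)) \<and>
     (\<forall>n\<in>space (configs V). P 0 n = return (configs V) n) \<and>
     (\<forall>s\<ge>0. \<forall>t\<ge>0. \<forall>n\<in>space (configs V). P (s + t) n = P s n \<bind> P t) \<and>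
     (\<forall>f. local_function V f \<longrightarrow> (\<forall>n\<in>space (configs V). \<forall>t\<ge>0.
        ((\<lambda>t. \<integral>m. f m \<partial>P t n) has_real_derivative
           (\<integral>m. parking_generator V E f m \<partial>P t n)) (at t within {0..})))"

text \<open>
  Occupation probability of the root at time \<open>t\<close>, started from the empty configuration and
  averaged over the dynamics and over the tree.
\<close>

definition mean_occupation ::
  "nat pmf \<Rightarrow> ((nat list \<Rightarrow> nat) \<Rightarrow> real \<Rightarrow> (nat list \<Rightarrow> bool) \<Rightarrow> (nat list \<Rightarrow> bool) measure)
     \<Rightarrow> real \<Rightarrow> real" where
  "mean_occupation a P t =
     (\<integral>D. (\<integral>n. of_bool (n []) \<partial>P D t (empty_config (tree_vertices D))) \<partial>tree_law a)"


section \<open>The generating function and \<open>\<alpha>\<close>\<close>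

definition gen_fun :: "nat pmf \<Rightarrow> real \<Rightarrow> real" where
  "gen_fun a s = (\<Sum>k. pmf a k * s ^ k)"

definition alpha_eq :: "nat pmf \<Rightarrow> real \<Rightarrow> real \<Rightarrow> bool" where
  "alpha_eq a u \<alpha> \<longleftrightarrow> ((\<lambda>x. x / gen_fun a x) has_integral u) {\<alpha>..1}"

definition alpha :: "nat pmf \<Rightarrow> real \<Rightarrow> real" where
  "alpha a u = (THE \<alpha>. 0 < \<alpha> \<and> \<alpha> \<le> 1 \<and> alpha_eq a u \<alpha>)"

end

theory Submission
  imports Defs
begin

text \<open>
  Look at the root only and ask whether it is still vacant. As long as a vertex \<open>i\<close> is vacant,
  the subtrees at its children evolve independently, each as if its parent were absent. Writing
  \<open>u = 1 - e\<^sup>-\<^sup>t\<close> for the probability that the clock of a given vertex has rung, the probability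
  \<open>q\<^sub>i\<close> that \<open>i\<close> is vacant, given that its parent is, should satisfy
  \<open>dq\<^sub>i/du = - (product of q\<^sub>j over the children j of i)\<close>. Averaging over i.i.d. degrees
  gives \<open>q' = - G(q)/q\<close>, whose solution with \<open>q(0) = 1\<close> is \<open>\<alpha>(u)\<close>, and for
  the root itself the occupation probability increases at rate \<open>G(\<alpha>) = - \<alpha> \<alpha>'\<close>, which
  integrates to \<open>(1 - \<alpha>\<^sup>2) / 2\<close>.

  The difficulty is that the process is only known through its forward equation, on an infinite tree
  whose degrees may even have infinite mean, so neither independence nor uniqueness comes for free.
  The argument therefore truncates. Freezing the vertices of generation \<open>n\<close> gives a finite
  system for which the recursion has an explicit solution \<open>vacancy n\<close>, started from an
  arbitrary configuration; it solves the backward equation of the truncated system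
  (\<open>vacancy_backward_equation\<close>). Arrivals in generation \<open>n\<close>, which the truncation
  suppresses, change it monotonically, with a sign that alternates with the parity of \<open>n\<close>,
  because blocking on a bipartite graph is attractive once the order is reversed on every other
  generation. Testing the forward equation against the truncated solution
  (\<open>parking_comparison\<close>) then traps the true vacancy probability of the root between
  truncations of even and of odd depth, for every single tree (\<open>root_vacancy_bracket\<close>).

  The truncated quantities are functionals of finitely many generations, so that their means over the
  tree can be computed: below the root they are the Picard iterates of \<open>q' = - G(q)/q\<close>, started
  from the constant \<open>1\<close>, and the root integrates \<open>G\<close> along such an iterate. Even iterates decrease to some \<open>U\<close>, odd ones increase to some \<open>L\<close>, and
  \<open>U' = - g(L)\<close>, \<open>L' = - g(U)\<close> with \<open>g(x) = G(x)/x\<close>. If \<open>H' = g\<close> then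
  \<open>H(U) - H(L)\<close> is conserved, hence zero, hence \<open>U = L\<close>
  (\<open>even_limit_eq_odd_limit\<close>). This replaces a Lipschitz estimate for \<open>g\<close>, which fails
  at \<open>1\<close> when the mean degree is infinite. The upper and lower bounds for the root therefore have
  the same mean in the limit, which forces the occupation probability to agree almost surely with a
  measurable function of the tree and determines its mean.
\<close>

section \<open>Comparison with subsolutions of the backward equation\<close>

text \<open>
  The set \<open>A\<close> is kept explicit because the comparison below expands a whole family of
  functions over one common finite set of coordinates.
\<close>

definition depends_on :: "'v set \<Rightarrow> 'v set \<Rightarrow> (('v \<Rightarrow> bool) \<Rightarrow> real) \<Rightarrow> bool" where
  "depends_on V A f \<longleftrightarrow> (\<forall>n\<in>space (configs V). \<forall>m\<in>space (configs V).
     (\<forall>i\<in>A. n i = m i) \<longrightarrow> f n = f m)"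

definition closed_nbhd :: "'v set \<Rightarrow> ('v \<times> 'v) set \<Rightarrow> 'v \<Rightarrow> 'v set" where
  "closed_nbhd V E k = {i\<in>V. graph_dist E i k \<le> 1}"

definition cylinder :: "'v set \<Rightarrow> 'v set \<Rightarrow> ('v \<Rightarrow> bool) \<Rightarrow> real" where
  "cylinder A c m = of_bool (\<forall>i\<in>A. m i = (i \<in> c))"

lemma local_function_depends_on:
  "finite A \<Longrightarrow> A \<subseteq> V \<Longrightarrow> depends_on V A f \<Longrightarrow> local_function V f"
  unfolding local_function_def depends_on_def by blast

lemma depends_on_cylinder: "depends_on V A (cylinder A c)"
  unfolding depends_on_def cylinder_def
  by (intro ballI impI arg_cong[where f=of_bool] ball_cong refl) simp

lemma space_configs: "space (configs V) = V \<rightarrow>\<^sub>E UNIV"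
  by (simp add: configs_def space_PiM)

lemma empty_config_space: "empty_config V \<in> space (configs V)"
  by (auto simp: space_configs empty_config_def)

lemma set_config_space: "(\<lambda>i\<in>V. i \<in> c) \<in> space (configs V)"
  by (auto simp: space_configs)

lemma park_space: "n \<in> space (configs V) \<Longrightarrow> k \<in> V \<Longrightarrow> n(k := True) \<in> space (configs V)"
  by (auto simp: space_configs PiE_def extensional_def)

text \<open>
  A function of finitely many occupation variables is a finite combination of cylinder indicators,
  with coefficients read off at configurations that are vacant outside \<open>A\<close>. This reduces
  measurability, and later the differentiation of time dependent functions, to cylinders.
\<close>

lemma cylinder_expansion:
  assumes "finite A" "A \<subseteq> V" "depends_on V A f" "m \<in> space (configs V)"
  shows "f m = (\<Sum>c\<in>Pow A. f (\<lambda>i\<in>V. i \<in> c) * cylinder A c m)"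
proof -
  let ?c = "{i\<in>A. m i}"
  have "(\<Sum>c\<in>Pow A. f (\<lambda>i\<in>V. i \<in> c) * cylinder A c m)
      = (\<Sum>c\<in>Pow A. if c = ?c then f (\<lambda>i\<in>V. i \<in> c) else 0)"
    by (intro sum.cong refl) (auto simp: cylinder_def)
  also have "\<dots> = f (\<lambda>i\<in>V. i \<in> ?c)"
    using assms(1) by (subst sum.delta) auto
  also have "\<dots> = f m"
    by (rule assms(3)[unfolded depends_on_def, rule_format, OF set_config_space assms(4)])
       (use assms(2) in auto)
  finally show ?thesis by simp
qed

lemma measurable_cylinder:
  assumes "finite A" "A \<subseteq> V"
  shows "cylinder A c \<in> borel_measurable (configs V)"
proof -
  have [measurable]: "(\<lambda>m. m i) \<in> configs V \<rightarrow>\<^sub>M count_space UNIV" if "i \<in> A" for i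
    unfolding configs_def using that assms(2) by (intro measurable_component_singleton) auto
  have [measurable]: "Measurable.pred (configs V) (\<lambda>m. m i = (i \<in> c))" if "i \<in> A" for i
    using that by measurable
  have "Measurable.pred (configs V) (\<lambda>m. \<forall>i\<in>A. m i = (i \<in> c))"
    using assms(1) by (intro pred_intros_finite) auto
  then show ?thesis
    unfolding cylinder_def[abs_def] by measurable
qed

lemma integrable_depends_on:
  assumes "finite A" "A \<subseteq> V" "depends_on V A f" "prob_space M" "sets M = sets (configs V)"
  shows "integrable M f"
proof -
  interpret prob_space M by fact
  have sp: "space M = space (configs V)"
    using assms(5) by (rule sets_eq_imp_space_eq)
  have "integrable M (cylinder A c)" for c
    using measurable_cylinder[OF assms(1,2), of c] assms(5)
    by (intro integrable_const_bound[where B=1])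
       (auto simp: cylinder_def measurable_cong_sets[OF assms(5) refl])
  then have "integrable M (\<lambda>m. \<Sum>c\<in>Pow A. f (\<lambda>i\<in>V. i \<in> c) * cylinder A c m)"
    by auto
  then show ?thesis
    using cylinder_expansion[OF assms(1-3)] sp
    by (subst Bochner_Integration.integrable_cong[OF refl]) auto
qed

lemma generator_finite:
  assumes "finite A" "A \<subseteq> V" "depends_on V A f" "m \<in> space (configs V)"
  shows "parking_generator V E f m = (\<Sum>k\<in>A. (f (m(k := True)) - f m) * parking_rate V E k m)"
proof -
  have "f (m(k := True)) = f m" if "k \<in> V - A" for k
    using that park_space[OF assms(4)] assms(4)
    by (intro assms(3)[unfolded depends_on_def, rule_format]) auto
  then have "parking_generator V E f m
      = (\<Sum>\<^sub>\<infinity>k\<in>A. (f (m(k := True)) - f m) * parking_rate V E k m)"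
    unfolding parking_generator_def using assms(2) by (intro infsum_cong_neutral) auto
  then show ?thesis using assms(1) by simp
qed

lemma generator_expansion:
  assumes "finite A" "A \<subseteq> V" "depends_on V A f" "m \<in> space (configs V)"
  shows "parking_generator V E f m
    = (\<Sum>c\<in>Pow A. f (\<lambda>i\<in>V. i \<in> c) * parking_generator V E (cylinder A c) m)"
proof -
  have "parking_generator V E f m
      = (\<Sum>k\<in>A. \<Sum>c\<in>Pow A. f (\<lambda>i\<in>V. i \<in> c) *
          ((cylinder A c (m(k := True)) - cylinder A c m) * parking_rate V E k m))"
  proof (subst generator_finite[OF assms], intro sum.cong refl)
    fix k assume "k \<in> A"
    then have mk: "m(k := True) \<in> space (configs V)"
      using assms(2,4) by (intro park_space) auto
    show "(f (m(k := True)) - f m) * parking_rate V E k m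
      = (\<Sum>c\<in>Pow A. f (\<lambda>i\<in>V. i \<in> c) *
          ((cylinder A c (m(k := True)) - cylinder A c m) * parking_rate V E k m))"
      unfolding cylinder_expansion[OF assms(1-3) mk] cylinder_expansion[OF assms]
      by (simp only: sum_subtractf[symmetric] sum_distrib_right right_diff_distrib left_diff_distrib mult.assoc)
  qed
  also have "\<dots> = (\<Sum>c\<in>Pow A. f (\<lambda>i\<in>V. i \<in> c) * parking_generator V E (cylinder A c) m)"
    by (subst sum.swap)
       (simp add: generator_finite[OF assms(1,2) depends_on_cylinder assms(4)] sum_distrib_left)
  finally show ?thesis .
qed

text \<open>
  The generator enlarges the set of relevant coordinates by one layer of neighbours only. On a
  locally finite graph it therefore maps local functions to local, hence integrable, functions.
\<close>

lemma depends_on_generator: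
  assumes "finite A" "A \<subseteq> V" "depends_on V A f"
  shows "depends_on V (A \<union> (\<Union>k\<in>A. closed_nbhd V E k)) (parking_generator V E f)"
  unfolding depends_on_def
proof (intro ballI impI)
  fix n m assume nm: "n \<in> space (configs V)" "m \<in> space (configs V)"
    "\<forall>i\<in>A \<union> (\<Union>k\<in>A. closed_nbhd V E k). n i = m i"
  have f: "f x = f y" if "x \<in> space (configs V)" "y \<in> space (configs V)" "\<forall>i\<in>A. x i = y i" for x y
    using assms(3) that unfolding depends_on_def by blast
  show "parking_generator V E f n = parking_generator V E f m"
    unfolding generator_finite[OF assms nm(1)] generator_finite[OF assms nm(2)]
  proof (intro sum.cong refl arg_cong2[where f="(*)"] arg_cong2[where f="(-)"])
    fix k assume k: "k \<in> A"
    show "f (n(k := True)) = f (m(k := True))"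
      using k nm assms(2) by (intro f) (auto intro!: park_space)
    show "f n = f m" using nm by (intro f) auto
    show "parking_rate V E k n = parking_rate V E k m"
      unfolding parking_rate_def using nm(3) k
      by (intro prod.cong refl) (auto simp: closed_nbhd_def)
  qed
qed

text \<open>
  The forward equation holds for fixed local functions; this extends it to functions that change in
  time. If \<open>h\<close> is a subsolution of the backward equation, then the mean of
  \<open>h (t - s)\<close> under the law at time \<open>s\<close> increases with \<open>s\<close>: the
  derivative in the first argument removes \<open>h'\<close>, while the forward equation adds the
  generator applied to \<open>h\<close>. Evaluating at \<open>s = 0\<close> and \<open>s = t\<close> gives the claim.
\<close>

theorem parking_comparison:
  fixes h h' :: "real \<Rightarrow> ('v \<Rightarrow> bool) \<Rightarrow> real"
  assumes P: "parking_process V E P"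
    and nbhd: "\<And>k. k \<in> V \<Longrightarrow> finite (closed_nbhd V E k)"
    and n: "n \<in> space (configs V)" and A: "finite A" "A \<subseteq> V" and t: "0 \<le> t"
    and dep: "\<And>r. 0 \<le> r \<Longrightarrow> depends_on V A (h r)" "\<And>r. 0 \<le> r \<Longrightarrow> depends_on V A (h' r)"
    and deriv: "\<And>r m. 0 \<le> r \<Longrightarrow> m \<in> space (configs V) \<Longrightarrow>
      ((\<lambda>r. h r m) has_real_derivative h' r m) (at r within {0..})"
    and le: "\<And>r m. 0 \<le> r \<Longrightarrow> m \<in> space (configs V) \<Longrightarrow> h' r m \<le> parking_generator V E (h r) m"
  shows "h t n \<le> (\<integral>m. h 0 m \<partial>P t n)"
proof -
  have PM: "prob_space (P s n)" "sets (P s n) = sets (configs V)" if "0 \<le> s" for s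
    using P that n unfolding parking_process_def
    by (auto dest!: measurable_space[of _ "configs V"] simp: space_prob_algebra)
  have sp: "space (P s n) = space (configs V)" if "0 \<le> s" for s
    using PM(2)[OF that] by (rule sets_eq_imp_space_eq)
  let ?x = "\<lambda>c. (\<lambda>i\<in>V. i \<in> c)"
  let ?B = "A \<union> (\<Union>k\<in>A. closed_nbhd V E k)"
  let ?G = "\<lambda>c. parking_generator V E (cylinder A c)"
  define p where "p c s = (\<integral>m. cylinder A c m \<partial>P s n)" for c s
  define q where "q c s = (\<integral>m. ?G c m \<partial>P s n)" for c s
  have B: "finite ?B" "?B \<subseteq> V" using A nbhd by (auto simp: closed_nbhd_def)
  have int_cyl: "integrable (P s n) (cylinder A c)" if "0 \<le> s" for c s
    using integrable_depends_on[OF A depends_on_cylinder PM[OF that]] .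
  have int_G: "integrable (P s n) (?G c)" if "0 \<le> s" for c s
    using integrable_depends_on[OF B depends_on_generator[OF A depends_on_cylinder] PM[OF that]] .
  have p_deriv: "(p c has_real_derivative q c s) (at s within {0..})" if "0 \<le> s" for c s
    using P that n local_function_depends_on[OF A depends_on_cylinder[of V A c]]
    unfolding parking_process_def p_def[abs_def] q_def by auto
  \<comment> \<open>Means are finite sums of cylinder probabilities, whose time derivatives are known.\<close>
  have exp1: "(\<integral>m. f m \<partial>P s n) = (\<Sum>c\<in>Pow A. f (?x c) * p c s)"
    if "0 \<le> s" "depends_on V A f" for f s
  proof -
    have "(\<integral>m. f m \<partial>P s n) = (\<integral>m. (\<Sum>c\<in>Pow A. f (?x c) * cylinder A c m) \<partial>P s n)"
      using that sp by (intro Bochner_Integration.integral_cong refl cylinder_expansion[OF A]) auto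
    then show ?thesis
      using int_cyl[OF that(1)] by (simp add: p_def)
  qed
  have exp2: "(\<integral>m. parking_generator V E f m \<partial>P s n) = (\<Sum>c\<in>Pow A. f (?x c) * q c s)"
    if "0 \<le> s" "depends_on V A f" for f s
  proof -
    have "(\<integral>m. parking_generator V E f m \<partial>P s n)
        = (\<integral>m. (\<Sum>c\<in>Pow A. f (?x c) * ?G c m) \<partial>P s n)"
      using that sp by (intro Bochner_Integration.integral_cong refl generator_expansion[OF A]) auto
    then show ?thesis
      using int_G[OF that(1)] by (simp add: q_def)
  qed
  define \<Phi> where "\<Phi> s = (\<Sum>c\<in>Pow A. h (t - s) (?x c) * p c s)" for s
  define \<Phi>' where "\<Phi>' s = (\<Sum>c\<in>Pow A. h (t - s) (?x c) * q c s + (- h' (t - s) (?x c)) * p c s)" for s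
  have \<Phi>_deriv: "(\<Phi> has_real_derivative \<Phi>' s) (at s within {0..t})" if "s \<in> {0..t}" for s
  proof -
    have 1: "((\<lambda>s. h (t - s) m) has_real_derivative h' (t - s) m * (- 1)) (at s within {0..t})"
      if "m \<in> space (configs V)" for m
    proof -
      have "((\<lambda>r. h r m) has_real_derivative h' (t - s) m) (at (t - s) within (\<lambda>s. t - s) ` {0..t})"
        using that \<open>s \<in> {0..t}\<close> by (intro DERIV_subset[OF deriv]) auto
      moreover have "((\<lambda>s. t - s) has_real_derivative - 1) (at s within {0..t})"
        by (auto intro!: derivative_eq_intros)
      ultimately show ?thesis
        by (drule_tac DERIV_image_chain) (auto simp: o_def)
    qed
    have 2: "(p c has_real_derivative q c s) (at s within {0..t})" for c
      using that by (intro DERIV_subset[OF p_deriv]) auto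
    have "((\<lambda>s. h (t - s) (?x c) * p c s) has_real_derivative
        h (t - s) (?x c) * q c s + (- h' (t - s) (?x c)) * p c s) (at s within {0..t})" for c
      using DERIV_mult[OF 1[OF set_config_space] 2] by (simp add: algebra_simps)
    then show ?thesis
      unfolding \<Phi>_def[abs_def] \<Phi>'_def by (intro DERIV_sum) auto
  qed
  have \<Phi>'_nonneg: "0 \<le> \<Phi>' s" if "s \<in> {0..t}" for s
  proof -
    have s: "0 \<le> s" "0 \<le> t - s" using that by auto
    have i1: "integrable (P s n) (parking_generator V E (h (t - s)))"
      using integrable_depends_on[OF B depends_on_generator[OF A dep(1)[OF s(2)]] PM[OF s(1)]] .
    have i2: "integrable (P s n) (h' (t - s))"
      using integrable_depends_on[OF A dep(2)[OF s(2)] PM[OF s(1)]] .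
    have "\<Phi>' s = (\<integral>m. parking_generator V E (h (t - s)) m \<partial>P s n) - (\<integral>m. h' (t - s) m \<partial>P s n)"
      unfolding \<Phi>'_def exp1[OF s(1) dep(2)[OF s(2)]] exp2[OF s(1) dep(1)[OF s(2)]]
      by (simp add: sum.distrib sum_negf sum_subtractf)
    also have "\<dots> \<ge> 0"
      using integral_mono[OF i2 i1] le s sp by auto
    finally show ?thesis .
  qed
  have "\<Phi> 0 \<le> \<Phi> t"
  proof (rule DERIV_nonneg_imp_increasing_open[OF t])
    fix s assume s: "0 < s" "s < t"
    then have "(\<Phi> has_real_derivative \<Phi>' s) (at s)"
      using \<Phi>_deriv[of s] at_within_Icc_at[of 0 s t] by auto
    then show "\<exists>y. (\<Phi> has_real_derivative y) (at s) \<and> 0 \<le> y"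
      using \<Phi>'_nonneg s by auto
  next
    show "continuous_on {0..t} \<Phi>"
      using \<Phi>_deriv DERIV_continuous_on by blast
  qed
  also have "\<Phi> 0 = (\<integral>m. h t m \<partial>P 0 n)"
    unfolding \<Phi>_def using exp1[of 0 "h t"] dep(1) t by simp
  also have "\<dots> = h t n"
  proof -
    have "P 0 n = return (configs V) n" using P n by (auto simp: parking_process_def)
    moreover have "h t \<in> borel_measurable (configs V)"
      using integrable_depends_on[OF A dep(1)[OF t] PM[of 0]] PM(2)[of 0]
      by (simp add: integrable_iff_bounded measurable_cong_sets[OF PM(2)[of 0] refl])
    ultimately show ?thesis using n by (simp add: integral_return)
  qed
  also have "\<Phi> t = (\<integral>m. h 0 m \<partial>P t n)"
    unfolding \<Phi>_def using exp1[of t "h 0"] dep(1) t by simp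
  finally show ?thesis .
qed


section \<open>Truncated trees\<close>

text \<open>
  The vertices that may still receive cars when the subtree at \<open>i\<close> is truncated by freezing
  generation \<open>n\<close>; those that the truncated system can see are obtained for \<open>Suc n\<close>.
\<close>

definition descendants :: "(nat list \<Rightarrow> nat) \<Rightarrow> nat \<Rightarrow> nat list \<Rightarrow> nat list set" where
  "descendants D n i = {k \<in> tree_vertices D. \<exists>y. k = i @ y \<and> length y < n}"

lemma descendants_0 [simp]: "descendants D 0 i = {}"
  by (auto simp: descendants_def)

lemma tree_vertices_prefix: "i @ y \<in> tree_vertices D \<Longrightarrow> i \<in> tree_vertices D"
proof (induction y rule: rev_induct)
  case (snoc x y)
  then show ?case
    by (metis append.assoc snoc_in_tree_vertices_iff)
qed simp

lemma tree_vertices_prefix_child: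
  assumes "i @ x # y \<in> tree_vertices D"
  shows "x < num_children D i" "i @ [x] \<in> tree_vertices D"
proof -
  have "(i @ [x]) @ y \<in> tree_vertices D" using assms by simp
  then show "i @ [x] \<in> tree_vertices D" by (rule tree_vertices_prefix)
  then show "x < num_children D i" by (simp add: snoc_in_tree_vertices_iff)
qed

lemma descendants_Suc:
  assumes "i \<in> tree_vertices D"
  shows "descendants D (Suc n) i = insert i (\<Union>x<num_children D i. descendants D n (i @ [x]))"
proof (intro equalityI subsetI)
  fix k assume "k \<in> descendants D (Suc n) i"
  then obtain y where k: "k = i @ y" "length y < Suc n" "i @ y \<in> tree_vertices D"
    by (auto simp: descendants_def)
  show "k \<in> insert i (\<Union>x<num_children D i. descendants D n (i @ [x]))"
  proof (cases y)
    case (Cons x z)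
    then show ?thesis
      using k tree_vertices_prefix_child[of i x z D] by (auto simp: descendants_def)
  qed (use k in auto)
next
  fix k assume "k \<in> insert i (\<Union>x<num_children D i. descendants D n (i @ [x]))"
  then consider "k = i" | x y where "k = i @ x # y" "k \<in> tree_vertices D" "length y < n"
    by (auto simp: descendants_def)
  then show "k \<in> descendants D (Suc n) i"
    using assms by cases (fastforce simp: descendants_def)+
qed

lemma finite_descendants: "finite (descendants D n i)"
proof (induction n arbitrary: i)
  case (Suc n)
  show ?case
  proof (cases "i \<in> tree_vertices D")
    case True
    then show ?thesis using Suc by (simp add: descendants_Suc)
  next
    case False
    then have "descendants D (Suc n) i = {}"
      using tree_vertices_prefix by (fastforce simp: descendants_def)
    then show ?thesis by simp
  qed
qed simp

lemma descendants_subset: "descendants D n i \<subseteq> tree_vertices D"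
  by (auto simp: descendants_def)

lemma sum_descendants_Suc:
  assumes "i \<in> tree_vertices D"
  shows "(\<Sum>k\<in>descendants D (Suc n) i. f k)
    = f i + (\<Sum>x<num_children D i. \<Sum>k\<in>descendants D n (i @ [x]). f k)"
proof -
  have "i \<notin> (\<Union>x<num_children D i. descendants D n (i @ [x]))"
    by (auto simp: descendants_def)
  moreover have "descendants D n (i @ [x]) \<inter> descendants D n (i @ [y]) = {}" if "x \<noteq> y" for x y
    using that by (auto simp: descendants_def)
  ultimately show ?thesis
    using finite_descendants
    by (simp add: descendants_Suc[OF assms] sum.UNION_disjoint)
qed

lemma graph_dist_le_1_iff: "graph_dist E i k \<le> 1 \<longleftrightarrow> i = k \<or> (i, k) \<in> E"
proof -
  have "x \<le> 1 \<longleftrightarrow> x < 2" for x :: enat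
    by (cases x) (auto simp: one_enat_def numeral_eq_enat)
  then have "graph_dist E i k \<le> 1 \<longleftrightarrow> (\<exists>m. (i, k) \<in> E ^^ m \<and> enat m < 2)"
    unfolding graph_dist_def by (simp add: INF_less_iff)
  also have "\<dots> \<longleftrightarrow> (i, k) \<in> E ^^ 0 \<or> (i, k) \<in> E ^^ 1"
  proof -
    have "enat m < 2 \<longleftrightarrow> m = 0 \<or> m = 1" for m
      by (auto simp: numeral_eq_enat)
    then show ?thesis by (simp only:) blast
  qed
  finally show ?thesis by auto
qed

lemma closed_nbhd_tree:
  assumes "k \<in> tree_vertices D"
  shows "closed_nbhd (tree_vertices D) (tree_edges D) k
    = insert k ((\<lambda>x. k @ [x]) ` {..<num_children D k} \<union> {p. \<exists>x. k = p @ [x]})"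
  using assms
  by (auto simp: closed_nbhd_def graph_dist_le_1_iff tree_edges_def snoc_in_tree_vertices_iff)

lemma finite_closed_nbhd_tree:
  assumes "k \<in> tree_vertices D"
  shows "finite (closed_nbhd (tree_vertices D) (tree_edges D) k)"
proof -
  have "{p. \<exists>x. k = p @ [x]} \<subseteq> {butlast k}" by auto
  then have "finite {p. \<exists>x. k = p @ [x]}" by (rule finite_subset) simp
  then show ?thesis unfolding closed_nbhd_tree[OF assms] by simp
qed

text \<open>
  When the parent is vacant, the only obstacles are below \<open>i\<close>. This is the shielding effect that
  decouples the subtrees.
\<close>

lemma parking_rate_vacant_parent:
  assumes "i \<in> tree_vertices D" "\<And>p x. i = p @ [x] \<Longrightarrow> \<not> m p"
  shows "parking_rate (tree_vertices D) (tree_edges D) i m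
    = (1 - of_bool (m i)) * (\<Prod>x<num_children D i. 1 - of_bool (m (i @ [x])))"
proof -
  let ?C = "(\<lambda>x. i @ [x]) ` {..<num_children D i}" and ?p = "{p. \<exists>x. i = p @ [x]}"
  have "parking_rate (tree_vertices D) (tree_edges D) i m
      = (\<Prod>j\<in>closed_nbhd (tree_vertices D) (tree_edges D) i. 1 - of_bool (m j))"
    by (simp add: parking_rate_def closed_nbhd_def)
  also have "\<dots> = (\<Prod>j\<in>insert i ?C. 1 - of_bool (m j))"
    using finite_closed_nbhd_tree[OF assms(1)] assms(2) unfolding closed_nbhd_tree[OF assms(1)]
    by (intro prod.mono_neutral_right) auto
  also have "\<dots> = (1 - of_bool (m i)) * (\<Prod>j\<in>?C. 1 - of_bool (m j))"
    by (subst prod.insert) auto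
  also have "(\<Prod>j\<in>?C. 1 - of_bool (m j)) = (\<Prod>x<num_children D i. 1 - of_bool (m (i @ [x])) :: real)"
    by (subst prod.reindex) (auto simp: inj_on_def)
  finally show ?thesis .
qed

lemma parking_rate_nonneg: "0 \<le> parking_rate V E k m"
  unfolding parking_rate_def by (intro prod_nonneg) auto

text \<open>
  The probability that \<open>i\<close> is vacant at time \<open>- ln (1 - u)\<close>, when the dynamics start
  from \<open>m\<close>, the parent of \<open>i\<close> is kept vacant, and the vertices of generation
  \<open>n\<close> below \<open>i\<close> are frozen. The integrand is the probability that no child blocks
  \<open>i\<close> when its clock rings. In the variable \<open>u\<close> the first ring is uniform on
  \<open>[0, 1]\<close>, so that no exponential weights appear. Later rings are irrelevant: a child that
  blocks the first one stays occupied.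
\<close>

fun vacancy :: "nat \<Rightarrow> (nat list \<Rightarrow> nat) \<Rightarrow> nat list \<Rightarrow> real \<Rightarrow> (nat list \<Rightarrow> bool) \<Rightarrow> real" where
  "vacancy 0 D i u m = 1 - of_bool (m i)"
| "vacancy (Suc n) D i u m = (1 - of_bool (m i)) *
     (1 - integral {0..u} (\<lambda>r. \<Prod>x<num_children D i. vacancy n D (i @ [x]) r m))"

fun vacancy_slope :: "nat \<Rightarrow> (nat list \<Rightarrow> nat) \<Rightarrow> nat list \<Rightarrow> real \<Rightarrow> (nat list \<Rightarrow> bool) \<Rightarrow> real" where
  "vacancy_slope 0 D i u m = 0"
| "vacancy_slope (Suc n) D i u m = - ((1 - of_bool (m i)) * (\<Prod>x<num_children D i. vacancy n D (i @ [x]) u m))"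

lemma vacancy_deriv:
  "u \<in> {0..1} \<Longrightarrow> ((\<lambda>u. vacancy n D i u m) has_real_derivative vacancy_slope n D i u m) (at u within {0..1})"
proof (induction n arbitrary: i u)
  case (Suc n)
  have "continuous_on {0..1} (\<lambda>r. \<Prod>x<num_children D i. vacancy n D (i @ [x]) r m)"
    by (intro continuous_on_prod DERIV_continuous_on[OF Suc.IH])
  from integral_has_real_derivative[OF this Suc.prems]
  have "((\<lambda>u. (1 - of_bool (m i)) *
      (1 - integral {0..u} (\<lambda>r. \<Prod>x<num_children D i. vacancy n D (i @ [x]) r m))) has_real_derivative
      (1 - of_bool (m i)) * (0 - (\<Prod>x<num_children D i. vacancy n D (i @ [x]) u m))) (at u within {0..1})"
    by (intro DERIV_cmult DERIV_diff DERIV_const)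
  then show ?case by simp
qed simp

lemma continuous_vacancy: "continuous_on {0..1} (\<lambda>u. vacancy n D i u m)"
  by (rule DERIV_continuous_on, rule vacancy_deriv)

lemma continuous_prod_vacancy: "continuous_on {0..1} (\<lambda>u. \<Prod>x\<in>X. vacancy n D (f x) u m)"
  by (intro continuous_on_prod continuous_vacancy)

lemma integrable_vacancy:
  assumes "u \<in> {0..1}"
  shows "(\<lambda>r. \<Prod>x\<in>X. vacancy n D (f x) r m) integrable_on {0..u}"
  by (intro integrable_continuous_real continuous_on_subset[OF continuous_prod_vacancy]) (use assms in simp)

lemma vacancy_bounds: "u \<in> {0..1} \<Longrightarrow> 0 \<le> vacancy n D i u m \<and> vacancy n D i u m \<le> 1"
proof (induction n arbitrary: i u)
  case (Suc n)
  let ?Q = "\<lambda>r. \<Prod>x<num_children D i. vacancy n D (i @ [x]) r m"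
  have Q: "0 \<le> ?Q r" "?Q r \<le> 1" if "r \<in> {0..u}" for r
  proof -
    have "r \<in> {0..1}" using Suc.prems that by auto
    then show "0 \<le> ?Q r" "?Q r \<le> 1"
      using Suc.IH[of r] by (simp_all add: prod_nonneg prod_le_1)
  qed
  have "0 \<le> integral {0..u} ?Q"
    using Q by (intro integral_nonneg integrable_vacancy Suc.prems) simp_all
  moreover have "integral {0..u} ?Q \<le> integral {0..u} (\<lambda>_. 1)"
    using Q by (intro integral_le integrable_vacancy integrable_const_ivl Suc.prems) simp_all
  then have "integral {0..u} ?Q \<le> 1"
    using Suc.prems by simp
  ultimately show ?case
    by (cases "m i") simp_all
qed simp

lemma vacancy_at_0: "vacancy n D i 0 m = 1 - of_bool (m i)"
  by (cases n) auto

lemma vacancy_cong: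
  assumes "i \<in> tree_vertices D" "\<And>k. k \<in> descendants D (Suc n) i \<Longrightarrow> m k = m' k"
  shows "vacancy n D i u m = vacancy n D i u m'"
  using assms
proof (induction n arbitrary: i u)
  case 0
  then show ?case by (simp add: descendants_Suc)
next
  case (Suc n)
  have "vacancy n D (i @ [x]) r m = vacancy n D (i @ [x]) r m'" if "x < num_children D i" for x r
    using that Suc.prems by (intro Suc.IH) (auto simp: snoc_in_tree_vertices_iff descendants_Suc[of i])
  moreover have "m i = m' i" using Suc.prems by (simp add: descendants_Suc)
  ultimately show ?case by simp
qed

text \<open>
  Additional cars in the frozen generation lower the vacancy of that generation itself and, since an
  occupied child protects its parent from being occupied, act with opposite signs on successive
  generations above.
\<close>

lemma vacancy_mono_boundary:
  assumes "\<And>y. length y < n \<Longrightarrow> m' (i @ y) = m (i @ y)"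
    and "\<And>y. length y = n \<Longrightarrow> m (i @ y) \<Longrightarrow> m' (i @ y)"
    and "u \<in> {0..1}"
  shows "(- 1) ^ n * vacancy n D i u m' \<le> (- 1) ^ n * vacancy n D i u m"
  using assms
proof (induction n arbitrary: i u)
  case 0
  then show ?case by (cases "m i") (auto dest: "0.prems"(2)[of "[]", simplified])
next
  case (Suc n)
  let ?Q = "\<lambda>m r. \<Prod>x<num_children D i. vacancy n D (i @ [x]) r m"
  have IH: "(- 1) ^ n * vacancy n D (i @ [x]) r m' \<le> (- 1) ^ n * vacancy n D (i @ [x]) r m"
    if "r \<in> {0..1}" for x r
    using Suc.prems(1,2)[of "x # _"] that by (intro Suc.IH) auto
  have "(- 1) ^ n * ?Q m' r \<le> (- 1) ^ n * ?Q m r" if "r \<in> {0..u}" for r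
  proof (cases "even n")
    case True
    then show ?thesis
      using IH[of r] that Suc.prems(3) vacancy_bounds[of r] by (auto intro!: prod_mono)
  next
    case False
    then show ?thesis
      using IH[of r] that Suc.prems(3) vacancy_bounds[of r] by (auto intro!: prod_mono)
  qed
  then have "integral {0..u} (\<lambda>r. (- 1) ^ n * ?Q m' r) \<le> integral {0..u} (\<lambda>r. (- 1) ^ n * ?Q m r)"
    by (intro integral_le integrable_on_mult_right integrable_vacancy Suc.prems) auto
  moreover have "m' i = m i" using Suc.prems(1)[of "[]"] by simp
  ultimately show ?case by (cases "m i") (auto simp: algebra_simps)
qed

lemma vacancy_flip_outside:
  assumes "i \<in> tree_vertices D" "k \<notin> descendants D (Suc n) i"
  shows "vacancy n D i u (m(k := True)) = vacancy n D i u m"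
proof (rule vacancy_cong[OF assms(1)])
  fix j assume "j \<in> descendants D (Suc n) i"
  then show "(m(k := True)) j = m j" using assms(2) by (cases "j = k") simp_all
qed

lemma prod_vacancy_flip:
  assumes i: "i \<in> tree_vertices D" and x: "x < num_children D i"
    and k: "k \<in> descendants D n (i @ [x])"
  shows "(\<Prod>y<num_children D i. vacancy n D (i @ [y]) r (m(k := True)))
      - (\<Prod>y<num_children D i. vacancy n D (i @ [y]) r m)
    = (vacancy n D (i @ [x]) r (m(k := True)) - vacancy n D (i @ [x]) r m)
      * (\<Prod>y\<in>{..<num_children D i} - {x}. vacancy n D (i @ [y]) r m)"
proof -
  have "vacancy n D (i @ [y]) r (m(k := True)) = vacancy n D (i @ [y]) r m"
    if "y \<in> {..<num_children D i} - {x}" for y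
  proof (rule vacancy_flip_outside)
    show "i @ [y] \<in> tree_vertices D" using i that by (simp add: snoc_in_tree_vertices_iff)
    show "k \<notin> descendants D (Suc n) (i @ [y])" using k that by (auto simp: descendants_def)
  qed
  then have "(\<Prod>y\<in>{..<num_children D i} - {x}. vacancy n D (i @ [y]) r (m(k := True)))
      = (\<Prod>y\<in>{..<num_children D i} - {x}. vacancy n D (i @ [y]) r m)"
    by (intro prod.cong refl)
  then show ?thesis
    using x by (simp add: prod.remove[of "{..<num_children D i}" x] left_diff_distrib)
qed

text \<open>
  The recursion really describes the dynamics: the generator, restricted to the vertices that are not
  frozen, acts on \<open>vacancy\<close> as the time derivative, where \<open>1 - u\<close> is \<open>du/dt\<close>.

  A flip below a child \<open>j\<close> changes only the factor of \<open>j\<close> in the product, so by induction the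
  flips below \<open>i\<close> contribute \<open>- (1 - r) Q'(r)\<close> integrated over \<open>[0, u]\<close>,
  where \<open>Q\<close> is the product over the children. Integration by parts turns this into boundary
  terms, and the contribution of the flip of \<open>i\<close> cancels the one at \<open>0\<close>.
\<close>

theorem vacancy_backward_equation:
  assumes "i \<in> tree_vertices D" "\<And>p x. i = p @ [x] \<Longrightarrow> \<not> m p" "u \<in> {0..1}"
  shows "(\<Sum>k\<in>descendants D n i. (vacancy n D i u (m(k := True)) - vacancy n D i u m)
      * parking_rate (tree_vertices D) (tree_edges D) k m) = (1 - u) * vacancy_slope n D i u m"
  using assms
proof (induction n arbitrary: i u)
  case (Suc n)
  let ?rate = "\<lambda>k. parking_rate (tree_vertices D) (tree_edges D) k m"
  let ?c = "num_children D i"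
  let ?v = "\<lambda>x r. vacancy n D (i @ [x]) r m"
  let ?Q = "\<lambda>r. \<Prod>x<?c. ?v x r"
  let ?Q' = "\<lambda>r. \<Sum>x<?c. vacancy_slope n D (i @ [x]) r m * (\<Prod>y\<in>{..<?c} - {x}. ?v y r)"
  let ?I = "integral {0..u} ?Q"
  let ?V = "vacancy (Suc n) D i u"
  show ?case
  proof (cases "m i")
    case True
    then have "?V (m(k := True)) = 0" "?V m = 0" "vacancy_slope (Suc n) D i u m = 0" for k
      by (cases "k = i", simp_all)
    then show ?thesis
      by (simp only: diff_self mult_zero_left mult_zero_right sum.neutral_const)
  next
    case False
    have sub: "{0..u} \<subseteq> {0..1}" using Suc.prems(3) by auto
    have root: "(?V (m(i := True)) - ?V m) * ?rate i = - ((1 - ?I) * ?Q 0)"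
      using False by (simp add: parking_rate_vacant_parent[OF Suc.prems(1,2)] vacancy_at_0 left_diff_distrib)
    have child: "(\<Sum>k\<in>descendants D n (i @ [x]). (?V (m(k := True)) - ?V m) * ?rate k)
        = - integral {0..u} (\<lambda>r. (1 - r) * (vacancy_slope n D (i @ [x]) r m * (\<Prod>y\<in>{..<?c} - {x}. ?v y r)))"
      if x: "x < ?c" for x
    proof -
      let ?d = "\<lambda>k r. vacancy n D (i @ [x]) r (m(k := True)) - ?v x r"
      let ?R = "\<lambda>r. \<Prod>y\<in>{..<?c} - {x}. ?v y r"
      have ix: "i @ [x] \<in> tree_vertices D" using x Suc.prems(1) by (simp add: snoc_in_tree_vertices_iff)
      have int: "(\<lambda>r. ?d k r * ?R r * ?rate k) integrable_on {0..u}" for k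
        by (intro integrable_continuous_real continuous_on_subset[OF _ sub] continuous_intros
            continuous_vacancy continuous_prod_vacancy)
      have "(?V (m(k := True)) - ?V m) * ?rate k = - integral {0..u} (\<lambda>r. ?d k r * ?R r * ?rate k)"
        if k: "k \<in> descendants D n (i @ [x])" for k
      proof -
        have "k \<noteq> i" using k by (auto simp: descendants_def)
        then have "?V (m(k := True)) - ?V m
            = - (integral {0..u} (\<lambda>r. \<Prod>y<?c. vacancy n D (i @ [y]) r (m(k := True))) - ?I)"
          using False by simp
        also have "\<dots> = - integral {0..u} (\<lambda>r. ?d k r * ?R r)"
          by (subst integral_diff[symmetric])
             (simp_all only: integrable_vacancy[OF Suc.prems(3)] prod_vacancy_flip[OF Suc.prems(1) x k])
        finally show ?thesis by simp
      qed
      then have "(\<Sum>k\<in>descendants D n (i @ [x]). (?V (m(k := True)) - ?V m) * ?rate k)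
          = - integral {0..u} (\<lambda>r. \<Sum>k\<in>descendants D n (i @ [x]). ?d k r * ?R r * ?rate k)"
        using int by (subst integral_sum) (simp_all add: finite_descendants sum_negf)
      also have "\<dots> = - integral {0..u} (\<lambda>r. (1 - r) * (vacancy_slope n D (i @ [x]) r m * ?R r))"
      proof (intro arg_cong[where f=uminus] integral_cong)
        fix r assume "r \<in> {0..u}"
        then have "(\<Sum>k\<in>descendants D n (i @ [x]). ?d k r * ?rate k) = (1 - r) * vacancy_slope n D (i @ [x]) r m"
          using ix False sub by (intro Suc.IH) auto
        then have "(\<Sum>k\<in>descendants D n (i @ [x]). ?d k r * ?rate k) * ?R r
            = (1 - r) * (vacancy_slope n D (i @ [x]) r m * ?R r)"
          by (simp only: mult.assoc)
        then show "(\<Sum>k\<in>descendants D n (i @ [x]). ?d k r * ?R r * ?rate k)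
            = (1 - r) * (vacancy_slope n D (i @ [x]) r m * ?R r)"
          by (simp only: sum_distrib_right mult.assoc mult.commute[of "?R r"])
      qed
      finally show ?thesis .
    qed
    have cont': "continuous_on {0..1} (\<lambda>r. vacancy_slope n D j r m)" for j
      by (cases n) (auto intro!: continuous_intros continuous_prod_vacancy)
    have "(\<Sum>x<?c. \<Sum>k\<in>descendants D n (i @ [x]). (?V (m(k := True)) - ?V m) * ?rate k)
        = - integral {0..u} (\<lambda>r. (1 - r) * ?Q' r)"
    proof -
      have "(\<lambda>r. (1 - r) * (vacancy_slope n D (i @ [x]) r m * (\<Prod>y\<in>{..<?c} - {x}. ?v y r))) integrable_on {0..u}" for x
        by (intro integrable_continuous_real continuous_on_subset[OF _ sub] continuous_intros
            continuous_prod_vacancy cont')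
      then have "(\<Sum>x<?c. - integral {0..u}
            (\<lambda>r. (1 - r) * (vacancy_slope n D (i @ [x]) r m * (\<Prod>y\<in>{..<?c} - {x}. ?v y r))))
          = - integral {0..u} (\<lambda>r. (1 - r) * ?Q' r)"
        by (simp add: sum_negf sum_distrib_left integral_sum)
      moreover have "(\<Sum>x<?c. \<Sum>k\<in>descendants D n (i @ [x]). (?V (m(k := True)) - ?V m) * ?rate k)
          = (\<Sum>x<?c. - integral {0..u}
            (\<lambda>r. (1 - r) * (vacancy_slope n D (i @ [x]) r m * (\<Prod>y\<in>{..<?c} - {x}. ?v y r))))"
        by (intro sum.cong refl child) simp
      ultimately show ?thesis by (simp only:)
    qed
    also have "integral {0..u} (\<lambda>r. (1 - r) * ?Q' r) = ((1 - u) * ?Q u + ?I) - ?Q 0"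
    proof -
      \<comment> \<open>Integration by parts, written out as a primitive of \<open>(1 - r) Q'(r)\<close>.\<close>
      let ?F = "\<lambda>r. (1 - r) * ?Q r + integral {0..r} ?Q"
      have "(?F has_real_derivative (1 - r) * ?Q' r) (at r within {0..u})" if "r \<in> {0..u}" for r
      proof -
        have r: "r \<in> {0..1}" using that sub by auto
        have Q: "(?Q has_real_derivative ?Q' r) (at r within {0..1})"
          using has_derivative_prod[of "{..<?c}" ?v, OF vacancy_deriv[OF r, unfolded has_field_derivative_def]]
          unfolding has_field_derivative_def
          by (rule has_derivative_eq_rhs) (simp add: fun_eq_iff sum_distrib_left sum_distrib_right mult_ac)
        have I: "((\<lambda>r. integral {0..r} ?Q) has_real_derivative ?Q r) (at r within {0..1})"
          by (intro integral_has_real_derivative continuous_prod_vacancy r)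
        have "((\<lambda>r. 1 - r) has_real_derivative (0 - 1)) (at r within {0..1})"
          by (intro DERIV_diff DERIV_const DERIV_ident)
        from DERIV_add[OF DERIV_mult[OF this Q] I] show ?thesis
          by (intro DERIV_subset[OF _ sub]) (simp add: algebra_simps)
      qed
      then have "((\<lambda>r. (1 - r) * ?Q' r) has_integral (?F u - ?F 0)) {0..u}"
        using Suc.prems(3)
        by (intro fundamental_theorem_of_calculus)
           (auto simp: has_real_derivative_iff_has_vector_derivative)
      then show ?thesis by (simp add: integral_unique)
    qed
    finally have children: "(\<Sum>x<?c. \<Sum>k\<in>descendants D n (i @ [x]). (?V (m(k := True)) - ?V m) * ?rate k)
        = - (((1 - u) * ?Q u + ?I) - ?Q 0)" .
    have total: "(\<Sum>k\<in>descendants D (Suc n) i. (?V (m(k := True)) - ?V m) * ?rate k)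
        = ?I * (?Q 0 - 1) - (1 - u) * ?Q u"
      unfolding sum_descendants_Suc[OF Suc.prems(1)] root children by (simp add: algebra_simps)
    \<comment> \<open>A child that is occupied at the start stays so; hence either \<open>Q(0) = 1\<close> or \<open>Q\<close> vanishes identically.\<close>
    have "?I * (?Q 0 - 1) = 0"
    proof (cases "\<exists>x<?c. m (i @ [x])")
      case True
      then obtain x where x: "x < ?c" "m (i @ [x])" by blast
      have "?v x r = 0" for r using x(2) by (cases n) simp_all
      then have "?Q = (\<lambda>_. 0)"
        using x(1) by (intro ext prod_zero) auto
      then show ?thesis by (simp only: integral_0 mult_zero_left)
    qed (simp add: vacancy_at_0)
    moreover have "(1 - u) * vacancy_slope (Suc n) D i u m = - ((1 - u) * ?Q u)" using False by simp
    ultimately show ?thesis by (simp only: total diff_0)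
  qed
qed simp

lemma depends_on_vacancy: "depends_on (tree_vertices D) (descendants D (Suc n) []) (vacancy n D [] u)"
  unfolding depends_on_def
proof (intro ballI impI)
  fix m m' :: "nat list \<Rightarrow> bool" assume "\<forall>k\<in>descendants D (Suc n) []. m k = m' k"
  then show "vacancy n D [] u m = vacancy n D [] u m'"
    by (intro vacancy_cong tree_vertices.root) blast
qed

lemma depends_on_vacancy_slope: "depends_on (tree_vertices D) (descendants D (Suc n) []) (vacancy_slope n D [] u)"
proof (cases n)
  case (Suc n')
  show ?thesis unfolding depends_on_def
  proof (intro ballI impI)
    fix m m' :: "nat list \<Rightarrow> bool" assume eq: "\<forall>k\<in>descendants D (Suc n) []. m k = m' k"
    have "vacancy n' D [x] u m = vacancy n' D [x] u m'" if "x < num_children D []" for x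
    proof (rule vacancy_cong)
      show "[x] \<in> tree_vertices D"
        using that tree_vertices.child[OF tree_vertices.root, of x D] by simp
      fix k assume "k \<in> descendants D (Suc n') [x]"
      then show "m k = m' k" using eq Suc by (auto simp: descendants_def)
    qed
    moreover have "m [] = m' []"
      using eq by (simp add: descendants_def tree_vertices.root)
    ultimately show "vacancy_slope n D [] u m = vacancy_slope n D [] u m'" using Suc by simp
  qed
qed (simp add: depends_on_def)

text \<open>
  The sign \<open>(- 1) ^ n\<close> says that truncation at an even depth overestimates the vacancy
  probability of the root and truncation at an odd depth underestimates it, whatever process on the
  infinite tree has been chosen.
\<close>

theorem root_vacancy_bracket:
  fixes D :: "nat list \<Rightarrow> nat"
  defines "V \<equiv> tree_vertices D" and "E \<equiv> tree_edges D"
  assumes P: "parking_process V E P" and t: "0 \<le> t"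
  shows "(- 1) ^ n * (1 - (\<integral>m. of_bool (m []) \<partial>P t (empty_config V)))
    \<le> (- 1) ^ n * vacancy n D [] (1 - exp (- t)) (\<lambda>_. False)"
proof -
  let ?A = "descendants D (Suc n) []"
  \<comment> \<open>The sign turns the truncated solution into a subsolution for either parity.\<close>
  define \<sigma> :: real where "\<sigma> = - ((- 1) ^ n)"
  define h where "h s m = \<sigma> * vacancy n D [] (1 - exp (- s)) m" for s m
  define h' where "h' s m = \<sigma> * (exp (- s) * vacancy_slope n D [] (1 - exp (- s)) m)" for s m
  have u01: "1 - exp (- s) \<in> {0..1}" if "0 \<le> s" for s :: real using that by simp
  have A: "finite ?A" "?A \<subseteq> V" using finite_descendants descendants_subset by (auto simp: V_def)
  have dep: "depends_on V ?A (h s)" "depends_on V ?A (h' s)" for s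
    using depends_on_vacancy[of D n] depends_on_vacancy_slope[of D n]
    unfolding depends_on_def h_def h'_def V_def by metis+
  have "h t (empty_config V) \<le> (\<integral>m. h 0 m \<partial>P t (empty_config V))"
  proof (rule parking_comparison[OF P _ empty_config_space A t dep])
    show "finite (closed_nbhd V E k)" if "k \<in> V" for k
      using that finite_closed_nbhd_tree by (simp add: V_def E_def)
  next
    fix s :: real and m :: "nat list \<Rightarrow> bool" assume s: "0 \<le> s"
    have "(\<lambda>s::real. 1 - exp (- s)) ` {0..} \<subseteq> {0..1}" by auto
    then have "((\<lambda>u. vacancy n D [] u m) has_real_derivative vacancy_slope n D [] (1 - exp (- s)) m)
        (at (1 - exp (- s)) within (\<lambda>s. 1 - exp (- s)) ` {0..})"
      by (rule DERIV_subset[OF vacancy_deriv[OF u01[OF s]]])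
    moreover have "((\<lambda>s::real. 1 - exp (- s)) has_real_derivative exp (- s)) (at s within {0..})"
      by (auto intro!: derivative_eq_intros)
    ultimately have "((\<lambda>u. vacancy n D [] u m) \<circ> (\<lambda>s. 1 - exp (- s)) has_real_derivative
        vacancy_slope n D [] (1 - exp (- s)) m * exp (- s)) (at s within {0..})"
      by (rule DERIV_image_chain)
    from DERIV_cmult[OF this, of \<sigma>]
    show "((\<lambda>s. h s m) has_real_derivative h' s m) (at s within {0..})"
      by (simp add: h_def h'_def o_def mult.commute)
  next
    fix s :: real and m :: "nat list \<Rightarrow> bool" assume s: "0 \<le> s" and m: "m \<in> space (configs V)"
    let ?v = "vacancy n D [] (1 - exp (- s))"
    let ?g = "\<lambda>k. (?v (m(k := True)) - ?v m) * parking_rate V E k m"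
    have "parking_generator V E (h s) m = \<sigma> * (\<Sum>k\<in>?A. ?g k)"
      unfolding generator_finite[OF A dep(1) m] sum_distrib_left
      by (intro sum.cong refl) (simp add: h_def right_diff_distrib left_diff_distrib mult.assoc)
    also have "?A = descendants D n [] \<union> {k \<in> tree_vertices D. length k = n}"
      by (auto simp: descendants_def)
    also have "(\<Sum>k\<in>\<dots>. ?g k)
        = (\<Sum>k\<in>descendants D n []. ?g k) + (\<Sum>k\<in>{k \<in> tree_vertices D. length k = n}. ?g k)"
    proof (rule sum.union_disjoint)
      have "{k \<in> tree_vertices D. length k = n} \<subseteq> ?A" by (auto simp: descendants_def)
      then show "finite {k \<in> tree_vertices D. length k = n}" by (rule finite_subset) (rule A)
      show "finite (descendants D n [])" by (rule finite_descendants)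
    qed (auto simp: descendants_def)
    also have "(\<Sum>k\<in>descendants D n []. ?g k) = exp (- s) * vacancy_slope n D [] (1 - exp (- s)) m"
      using vacancy_backward_equation[of "[]" D m "1 - exp (- s)" n] u01[OF s]
      by (simp add: V_def E_def tree_vertices.root)
    finally have gen: "parking_generator V E (h s) m
        = h' s m + (\<Sum>k\<in>{k \<in> tree_vertices D. length k = n}. \<sigma> * ?g k)"
      by (simp add: h'_def distrib_left sum_distrib_left del: fun_upd_apply)
    have "0 \<le> \<sigma> * ?g k" if "length k = n" for k
    proof -
      have "(- 1) ^ n * ?v (m(k := True)) \<le> (- 1) ^ n * ?v m"
        using that u01[OF s] by (intro vacancy_mono_boundary) auto
      then have "0 \<le> \<sigma> * (?v (m(k := True)) - ?v m)"
        by (simp add: \<sigma>_def right_diff_distrib)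
      then show ?thesis
        by (simp add: mult.assoc[symmetric] parking_rate_nonneg)
    qed
    then show "h' s m \<le> parking_generator V E (h s) m"
      unfolding gen by (intro add_increasing2 sum_nonneg order_refl) blast
  qed
  also have "h t (empty_config V) = \<sigma> * vacancy n D [] (1 - exp (- t)) (\<lambda>_. False)"
  proof -
    have "vacancy n D [] (1 - exp (- t)) (empty_config V) = vacancy n D [] (1 - exp (- t)) (\<lambda>_. False)"
      using descendants_subset[of D "Suc n" "[]"]
      by (intro vacancy_cong tree_vertices.root) (auto simp: empty_config_def V_def)
    then show ?thesis by (simp add: h_def)
  qed
  also have "(\<integral>m. h 0 m \<partial>P t (empty_config V))
      = \<sigma> * (1 - (\<integral>m. of_bool (m []) \<partial>P t (empty_config V)))"
  proof -
    have M: "prob_space (P t (empty_config V))" "sets (P t (empty_config V)) = sets (configs V)"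
      using P t empty_config_space[of V] unfolding parking_process_def
      by (auto dest!: measurable_space[of _ "configs V"] simp: space_prob_algebra)
    interpret prob_space "P t (empty_config V)" by (rule M)
    have "depends_on V {[]} (\<lambda>m. of_bool (m []))"
      unfolding depends_on_def by (intro ballI impI arg_cong[where f=of_bool]) simp
    then have "integrable (P t (empty_config V)) (\<lambda>m. of_bool (m []) :: real)"
      using M by (intro integrable_depends_on[of "{[]}" V]) (auto simp: V_def tree_vertices.root)
    then show ?thesis
      by (simp add: h_def vacancy_at_0 prob_space)
  qed
  finally show ?thesis by (simp add: \<sigma>_def)
qed


section \<open>The differential equation for the vacancy probability\<close>

text \<open>
  The Picard iterates of \<open>q' = - g(q)\<close>, \<open>q(0) = 1\<close>, started from the constant
  \<open>1\<close>.
\<close>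

primrec picard :: "(real \<Rightarrow> real) \<Rightarrow> nat \<Rightarrow> real \<Rightarrow> real" where
  "picard g 0 u = 1"
| "picard g (Suc n) u = 1 - integral {0..u} (\<lambda>r. g (picard g n r))"

text \<open>
  The properties of \<open>g(x) = G(x) / x\<close> that matter for \<open>q' = - g(q)\<close> on \<open>[0, 1]\<close>.
  Uniqueness of the solution will come from monotonicity instead of a Lipschitz bound, because the
  derivative of \<open>G\<close> at \<open>1\<close> is the mean degree, which may be infinite.
\<close>

locale antitone_flow =
  fixes g :: "real \<Rightarrow> real"
  assumes continuous: "continuous_on {0..1} g"
    and mono: "\<And>x y. 0 \<le> x \<Longrightarrow> x \<le> y \<Longrightarrow> y \<le> 1 \<Longrightarrow> g x \<le> g y"
    and nonneg: "\<And>x. 0 \<le> x \<Longrightarrow> x \<le> 1 \<Longrightarrow> 0 \<le> g x"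
    and pos: "\<And>x. 0 < x \<Longrightarrow> x \<le> 1 \<Longrightarrow> 0 < g x"
    and le_self: "\<And>x. 0 \<le> x \<Longrightarrow> x \<le> 1 \<Longrightarrow> g x \<le> x"
begin

lemma continuous_comp:
  assumes "continuous_on {0..1} f" "\<And>r. r \<in> {0..1} \<Longrightarrow> f r \<in> {0..1}"
  shows "continuous_on {0..1} (\<lambda>r. g (f r))"
  by (rule continuous_on_compose2[OF continuous assms(1)]) (use assms(2) in auto)

lemma integral_step_bounds:
  fixes u :: real
  assumes "(\<lambda>r. g (f r)) integrable_on {0..u}" "u \<in> {0..1}" "\<And>r. r \<in> {0..u} \<Longrightarrow> f r \<in> {0..1}"
  shows "0 \<le> integral {0..u} (\<lambda>r. g (f r))" "integral {0..u} (\<lambda>r. g (f r)) \<le> 1"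
proof -
  have f: "0 \<le> g (f r)" "g (f r) \<le> 1" if "r \<in> {0..u}" for r
    using assms(3)[OF that] nonneg[of "f r"] le_self[of "f r"] by auto
  show "0 \<le> integral {0..u} (\<lambda>r. g (f r))"
    using f by (intro integral_nonneg assms(1)) simp_all
  have "integral {0..u} (\<lambda>r. g (f r)) \<le> integral {0..u} (\<lambda>_. 1)"
    using f by (intro integral_le assms(1)) (simp_all add: integrable_const_ivl)
  then show "integral {0..u} (\<lambda>r. g (f r)) \<le> 1" using assms(2) by simp
qed

lemma picard_bounds_continuous:
  "continuous_on {0..1} (picard g n)" "u \<in> {0..1} \<Longrightarrow> picard g n u \<in> {0..1}"
proof (induction n arbitrary: u)
  case (Suc n)
  have c: "continuous_on {0..1} (\<lambda>r. g (picard g n r))"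
    by (rule continuous_comp[OF Suc.IH])
  {
    case 1
    show ?case
      unfolding picard.simps
      by (intro continuous_on_diff continuous_on_const indefinite_integral_continuous_1
          integrable_continuous_real c)
  next
    case 2
    then have "(\<lambda>r. g (picard g n r)) integrable_on {0..u}"
      by (intro integrable_continuous_real continuous_on_subset[OF c]) auto
    from integral_step_bounds[OF this 2] Suc.IH(2) 2 show ?case by simp
  }
qed (simp_all add: continuous_on_const)

lemma continuous_picard: "continuous_on {0..1} (\<lambda>r. g (picard g n r))"
  by (rule continuous_comp[OF picard_bounds_continuous])

lemma integrable_picard: "u \<in> {0..1} \<Longrightarrow> (\<lambda>r. g (picard g n r)) integrable_on {0..u}"
  by (intro integrable_continuous_real continuous_on_subset[OF continuous_picard]) auto

text \<open>
  One step is order reversing, so two steps preserve order; as the iteration starts at the largest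
  possible value, even iterates decrease and odd iterates increase.
\<close>

lemma picard_alternating:
  "u \<in> {0..1} \<Longrightarrow> (- 1) ^ n * picard g (n + 2) u \<le> (- 1) ^ n * picard g n u"
proof (induction n arbitrary: u)
  case 0
  show ?case using picard_bounds_continuous(2)[OF 0, of "0 + 2"] by (simp del: picard.simps(2))
next
  case (Suc n)
  have "(- 1) ^ n * g (picard g (n + 2) r) \<le> (- 1) ^ n * g (picard g n r)" if "r \<in> {0..u}" for r
  proof -
    have r: "r \<in> {0..1}" using that Suc.prems by auto
    show ?thesis
      using Suc.IH[OF r] picard_bounds_continuous(2)[OF r, of n] picard_bounds_continuous(2)[OF r, of "n + 2"]
      by (cases "even n") (simp_all add: mono)
  qed
  then have "integral {0..u} (\<lambda>r. (- 1) ^ n * g (picard g (n + 2) r))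
      \<le> integral {0..u} (\<lambda>r. (- 1) ^ n * g (picard g n r))"
    by (intro integral_le integrable_on_mult_right integrable_picard Suc.prems)
  then show ?case by (simp add: algebra_simps)
qed

definition even_limit :: "real \<Rightarrow> real" where
  "even_limit u = lim (\<lambda>n. picard g (2 * n) u)"

definition odd_limit :: "real \<Rightarrow> real" where
  "odd_limit u = lim (\<lambda>n. picard g (2 * n + 1) u)"

lemma picard_limits:
  assumes "u \<in> {0..1}"
  shows "(\<lambda>n. picard g (2 * n) u) \<longlonglongrightarrow> even_limit u" "(\<lambda>n. picard g (2 * n + 1) u) \<longlonglongrightarrow> odd_limit u"
proof -
  have bseq: "Bseq (\<lambda>n. picard g (f n) u)" for f :: "nat \<Rightarrow> nat"
    using picard_bounds_continuous(2)[OF assms] by (intro BseqI'[where K=1]) auto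
  have "decseq (\<lambda>n. picard g (2 * n) u)"
    using picard_alternating[OF assms, of "2 * _"] by (intro decseq_SucI) (simp del: picard.simps)
  then show "(\<lambda>n. picard g (2 * n) u) \<longlonglongrightarrow> even_limit u"
    unfolding even_limit_def using bseq
    by (intro convergent_LIMSEQ_iff[THEN iffD1] Bseq_monoseq_convergent) (auto simp: monoseq_iff simp del: picard.simps)
  have "incseq (\<lambda>n. picard g (2 * n + 1) u)"
    using picard_alternating[OF assms, of "2 * _ + 1"] by (intro incseq_SucI) (simp del: picard.simps)
  then show "(\<lambda>n. picard g (2 * n + 1) u) \<longlonglongrightarrow> odd_limit u"
    unfolding odd_limit_def using bseq
    by (intro convergent_LIMSEQ_iff[THEN iffD1] Bseq_monoseq_convergent) (auto simp: monoseq_iff simp del: picard.simps)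
qed

lemma limits_in_unit:
  assumes "u \<in> {0..1}"
  shows "even_limit u \<in> {0..1}" "odd_limit u \<in> {0..1}"
  by (rule closed_sequentially[OF closed_atLeastAtMost _ picard_limits(1)[OF assms]],
      rule picard_bounds_continuous(2)[OF assms])
     (rule closed_sequentially[OF closed_atLeastAtMost _ picard_limits(2)[OF assms]],
      rule picard_bounds_continuous(2)[OF assms])

lemma integral_limit:
  fixes f :: "real \<Rightarrow> real" and u :: real
  assumes f: "continuous_on {0..1} f" "\<And>n r. r \<in> {0..1} \<Longrightarrow> p n r \<in> {0..1}"
    and p: "\<And>n. continuous_on {0..1} (p n)"
    and lim: "\<And>r. r \<in> {0..1} \<Longrightarrow> (\<lambda>n. p n r) \<longlonglongrightarrow> q r" and u: "u \<in> {0..1}"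
  shows "(\<lambda>r. f (q r)) integrable_on {0..u}"
    "(\<lambda>n. integral {0..u} (\<lambda>r. f (p n r))) \<longlonglongrightarrow> integral {0..u} (\<lambda>r. f (q r))"
proof -
  obtain B where B: "\<And>x. x \<in> {0..1} \<Longrightarrow> norm (f x) \<le> B"
    using compact_imp_bounded[OF compact_continuous_image[OF f(1) compact_Icc]]
    unfolding bounded_iff by blast
  have q: "q r \<in> {0..1}" if "r \<in> {0..1}" for r
    using f(2)[OF that] by (rule closed_sequentially[OF closed_atLeastAtMost _ lim[OF that]])
  have int: "(\<lambda>r. f (p n r)) integrable_on {0..u}" for n
  proof (rule integrable_continuous_real)
    have "continuous_on {0..1} (\<lambda>r. f (p n r))"
      by (rule continuous_on_compose2[OF f(1) p]) (use f(2) in auto)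
    then show "continuous_on {0..u} (\<lambda>r. f (p n r))"
      by (rule continuous_on_subset) (use u in auto)
  qed
  have conv: "(\<lambda>n. f (p n r)) \<longlonglongrightarrow> f (q r)" if "r \<in> {0..u}" for r
  proof -
    have r: "r \<in> {0..1}" using that u by auto
    show ?thesis
      by (rule continuous_on_tendsto_compose[OF f(1) lim[OF r] q[OF r]]) (use f(2)[OF r] in simp)
  qed
  have bnd: "norm (f (p n r)) \<le> B" if "r \<in> {0..u}" for n r
    using that u by (intro B f(2)) auto
  show "(\<lambda>r. f (q r)) integrable_on {0..u}"
    by (rule dominated_convergence(1)[OF int integrable_const_ivl bnd conv])
  show "(\<lambda>n. integral {0..u} (\<lambda>r. f (p n r))) \<longlonglongrightarrow> integral {0..u} (\<lambda>r. f (q r))"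
    by (rule dominated_convergence(2)[OF int integrable_const_ivl bnd conv])
qed

text \<open>
  Each of the two limits is one Picard step applied to the other.
\<close>

lemma limits_integral_equations:
  assumes "u \<in> {0..1}"
  shows "even_limit u = 1 - integral {0..u} (\<lambda>r. g (odd_limit r))"
    "odd_limit u = 1 - integral {0..u} (\<lambda>r. g (even_limit r))"
    "(\<lambda>r. g (odd_limit r)) integrable_on {0..u}" "(\<lambda>r. g (even_limit r)) integrable_on {0..u}"
proof -
  note odd = integral_limit[OF continuous picard_bounds_continuous(2,1) picard_limits(2) assms]
  note even = integral_limit[OF continuous picard_bounds_continuous(2,1) picard_limits(1) assms]
  show "(\<lambda>r. g (odd_limit r)) integrable_on {0..u}"
    by (rule odd(1))
  show "(\<lambda>r. g (even_limit r)) integrable_on {0..u}"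
    by (rule even(1))
  have "(\<lambda>n. picard g (2 * n + 1) u) \<longlonglongrightarrow> 1 - integral {0..u} (\<lambda>r. g (even_limit r))"
    using tendsto_diff[OF tendsto_const even(2)] by simp
  then show "odd_limit u = 1 - integral {0..u} (\<lambda>r. g (even_limit r))"
    by (rule LIMSEQ_unique[OF picard_limits(2)[OF assms]])
  have "(\<lambda>n. picard g (2 * Suc n) u) \<longlonglongrightarrow> 1 - integral {0..u} (\<lambda>r. g (odd_limit r))"
    using tendsto_diff[OF tendsto_const odd(2)] by simp
  moreover have "(\<lambda>n. picard g (2 * Suc n) u) \<longlonglongrightarrow> even_limit u"
    using picard_limits(1)[OF assms] by (rule LIMSEQ_Suc)
  ultimately show "even_limit u = 1 - integral {0..u} (\<lambda>r. g (odd_limit r))"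
    using LIMSEQ_unique by blast
qed

lemma continuous_limits: "continuous_on {0..1} even_limit" "continuous_on {0..1} odd_limit"
proof -
  have "continuous_on {0..1} (\<lambda>u. 1 - integral {0..u} (\<lambda>r. g (odd_limit r)))"
    "continuous_on {0..1} (\<lambda>u. 1 - integral {0..u} (\<lambda>r. g (even_limit r)))"
    using limits_integral_equations(3,4)[of 1]
    by (auto intro!: continuous_intros indefinite_integral_continuous_1)
  then show "continuous_on {0..1} even_limit" "continuous_on {0..1} odd_limit"
    using limits_integral_equations(1,2) by (simp_all cong: continuous_on_cong_simp)
qed

lemma limits_deriv:
  assumes "u \<in> {0..1}"
  shows "(even_limit has_real_derivative - g (odd_limit u)) (at u within {0..1})"
    "(odd_limit has_real_derivative - g (even_limit u)) (at u within {0..1})"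
proof -
  have *: "(h has_real_derivative - g (f u)) (at u within {0..1})"
    if "continuous_on {0..1} f" "\<And>r. r \<in> {0..1} \<Longrightarrow> f r \<in> {0..1}"
      "\<And>u. u \<in> {0..1} \<Longrightarrow> h u = 1 - integral {0..u} (\<lambda>r. g (f r))" for f h
  proof -
    have "((\<lambda>u. 1 - integral {0..u} (\<lambda>r. g (f r))) has_real_derivative 0 - g (f u)) (at u within {0..1})"
      by (intro DERIV_diff DERIV_const integral_has_real_derivative continuous_comp that assms)
    from has_field_derivative_transform_within[OF this zero_less_one assms, of h] show ?thesis
      by (simp add: that(3))
  qed
  show "(even_limit has_real_derivative - g (odd_limit u)) (at u within {0..1})"
    by (rule *[OF continuous_limits(2) limits_in_unit(2) limits_integral_equations(1)])
  show "(odd_limit has_real_derivative - g (even_limit u)) (at u within {0..1})"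
    by (rule *[OF continuous_limits(1) limits_in_unit(1) limits_integral_equations(2)])
qed

text \<open>
  Positivity of \<open>g\<close> away from \<open>0\<close> makes its primitive strictly increasing.
\<close>

lemma integral_g_inj:
  assumes "x \<in> {0..1}" "y \<in> {0..1}" "integral {0..x} g = integral {0..y} g"
  shows "x = y"
proof -
  have strict: "integral {0..x} g < integral {0..y} g" if "0 \<le> x" "x < y" "y \<le> 1" for x y
  proof (rule DERIV_pos_imp_increasing_open[OF that(2)])
    fix z assume z: "x < z" "z < y"
    then have "((\<lambda>x. integral {0..x} g) has_real_derivative g z) (at z within {0..1})"
      using that by (intro integral_has_real_derivative continuous) auto
    then show "\<exists>d. ((\<lambda>x. integral {0..x} g) has_real_derivative d) (at z) \<and> 0 < d"
      using z that pos[of z] by (auto simp: at_within_Icc_at)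
  next
    have "continuous_on {0..1} (\<lambda>x. integral {0..x} g)"
      by (intro indefinite_integral_continuous_1 integrable_continuous_real continuous)
    then show "continuous_on {x..y} (\<lambda>x. integral {0..x} g)"
      by (rule continuous_on_subset) (use that in auto)
  qed
  show ?thesis
    using strict[of x y] strict[of y x] assms by (cases x y rule: linorder_cases) auto
qed

text \<open>
  The coupled system \<open>U' = - g(L)\<close>, \<open>L' = - g(U)\<close> conserves
  \<open>H(U) - H(L)\<close>, where \<open>H' = g\<close>, because both terms change at rate
  \<open>- g(U) g(L)\<close>. The difference vanishes at the start, and \<open>H\<close> is injective.
\<close>

theorem even_limit_eq_odd_limit:
  assumes "u \<in> {0..1}"
  shows "even_limit u = odd_limit u"
proof -
  let ?H = "\<lambda>y. integral {0..y} g"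
  have H: "((\<lambda>u. ?H (f u)) has_real_derivative g (f u) * d) (at u within {0..1})"
    if "(f has_real_derivative d) (at u within {0..1})" "\<And>r. r \<in> {0..1} \<Longrightarrow> f r \<in> {0..1}" "u \<in> {0..1}"
    for f d u
  proof -
    have "(?H has_real_derivative g (f u)) (at (f u) within f ` {0..1})"
      by (rule DERIV_subset[OF integral_has_real_derivative[OF continuous that(2)[OF that(3)]]])
         (use that(2) in blast)
    from DERIV_image_chain[OF this that(1)] show ?thesis by (simp add: o_def)
  qed
  have "\<exists>c. \<forall>u\<in>{0..1}. ?H (even_limit u) - ?H (odd_limit u) = c"
  proof (rule has_field_derivative_zero_constant)
    fix u :: real assume u: "u \<in> {0..1}"
    show "((\<lambda>u. ?H (even_limit u) - ?H (odd_limit u)) has_real_derivative 0) (at u within {0..1})"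
      using DERIV_diff[OF H[OF limits_deriv(1)[OF u] limits_in_unit(1) u]
          H[OF limits_deriv(2)[OF u] limits_in_unit(2) u]] by (simp add: mult.commute)
  qed simp
  then obtain c where c: "\<And>u. u \<in> {0..1} \<Longrightarrow> ?H (even_limit u) - ?H (odd_limit u) = c" by blast
  have "c = 0"
    using c[of 0] limits_integral_equations(1,2)[of 0] by simp
  then have "?H (even_limit u) = ?H (odd_limit u)" using c[OF assms] by simp
  then show ?thesis by (rule integral_g_inj[OF limits_in_unit[OF assms]])
qed

lemma picard_tendsto:
  assumes "u \<in> {0..1}"
  shows "(\<lambda>n. picard g (2 * n) u) \<longlonglongrightarrow> even_limit u" "(\<lambda>n. picard g (2 * n + 1) u) \<longlonglongrightarrow> even_limit u"
  using picard_limits[OF assms] even_limit_eq_odd_limit[OF assms] by simp_all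

lemma even_limit_deriv:
  "u \<in> {0..1} \<Longrightarrow> (even_limit has_real_derivative - g (even_limit u)) (at u within {0..1})"
  using limits_deriv(1) even_limit_eq_odd_limit by simp

lemma even_limit_0: "even_limit 0 = 1"
  using limits_integral_equations(1)[of 0] by simp

text \<open>
  Since \<open>g(x) \<le> x\<close>, the solution decays at most exponentially. This keeps it away from
  \<open>0\<close>, where \<open>1 / g\<close> is singular.
\<close>

lemma even_limit_ge_exp:
  assumes "u \<in> {0..1}"
  shows "exp (- u) \<le> even_limit u"
proof -
  have "even_limit 0 * exp 0 \<le> even_limit u * exp u"
  proof (rule DERIV_nonneg_imp_increasing_open[of 0 u "\<lambda>u. even_limit u * exp u"])
    fix x assume "0 < x" "x < u"
    then have x: "x \<in> {0..1}" and "at x within {0..1} = at x"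
      using assms by (simp_all add: at_within_Icc_at)
    then have "(even_limit has_real_derivative - g (even_limit x)) (at x)"
      using even_limit_deriv[OF x] by simp
    then have "((\<lambda>u. even_limit u * exp u) has_real_derivative
        even_limit x * exp x + - g (even_limit x) * exp x) (at x)"
      by (intro DERIV_mult' DERIV_exp)
    moreover have "0 \<le> (even_limit x - g (even_limit x)) * exp x"
      using le_self[of "even_limit x"] limits_in_unit(1)[OF x] by simp
    ultimately show "\<exists>y. ((\<lambda>u. even_limit u * exp u) has_real_derivative y) (at x) \<and> 0 \<le> y"
      by (auto simp: algebra_simps)
  next
    show "continuous_on {0..u} (\<lambda>u. even_limit u * exp u)"
      by (intro continuous_intros continuous_on_subset[OF continuous_limits(1)]) (use assms in auto)
  qed (use assms in simp)
  then show ?thesis by (simp add: even_limit_0 exp_minus field_simps)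
qed

lemma continuous_inverse_g: "0 < a \<Longrightarrow> continuous_on {a..1} (\<lambda>x. 1 / g x)"
  using pos by (intro continuous_intros continuous_on_subset[OF continuous]) (auto simp: less_le)

text \<open>
  The time that a solution of \<open>q' = - g(q)\<close> takes from \<open>1\<close> down to \<open>y\<close>.
  For \<open>g(x) = G(x) / x\<close> it is the left-hand side of the equation that defines \<open>\<alpha>\<close>.
\<close>

definition passage_time :: "real \<Rightarrow> real" where
  "passage_time y = integral {y..1} (\<lambda>x. 1 / g x)"

lemma passage_time_deriv:
  assumes "0 < a" "y \<in> {a..1}"
  shows "(passage_time has_real_derivative - (1 / g y)) (at y within {a..1})"
  unfolding passage_time_def[abs_def]
  by (rule integral_has_real_derivative'[OF continuous_inverse_g]) (use assms in auto)

lemma passage_time_strict_antimono: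
  assumes "0 < x" "x < y" "y \<le> 1"
  shows "passage_time y < passage_time x"
proof (rule DERIV_neg_imp_decreasing_open[OF assms(2)])
  fix z assume z: "x < z" "z < y"
  then have "(passage_time has_real_derivative - (1 / g z)) (at z within {x..1})"
    using assms by (intro passage_time_deriv) auto
  then show "\<exists>d. (passage_time has_real_derivative d) (at z) \<and> d < 0"
    using z assms pos[of z] by (intro exI[of _ "- (1 / g z)"]) (simp add: at_within_Icc_at)
next
  have "continuous_on {x..1} passage_time"
    using passage_time_deriv[OF assms(1)] by (rule DERIV_continuous_on)
  then show "continuous_on {x..y} passage_time"
    by (rule continuous_on_subset) (use assms in auto)
qed

lemma passage_time_inj:
  "0 < x \<Longrightarrow> x \<le> 1 \<Longrightarrow> 0 < y \<Longrightarrow> y \<le> 1 \<Longrightarrow> passage_time x = passage_time y \<Longrightarrow> x = y"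
  using passage_time_strict_antimono[of x y] passage_time_strict_antimono[of y x]
  by (cases x y rule: linorder_cases) auto

text \<open>
  Comparison with \<open>1 / x \<le> 1 / g(x)\<close>: the passage time is unbounded near \<open>0\<close>, so that
  \<open>\<alpha>(u)\<close> exists for all \<open>u \<ge> 0\<close>.
\<close>

lemma passage_time_exp: "0 \<le> u \<Longrightarrow> u \<le> passage_time (exp (- u))"
proof -
  assume u: "0 \<le> u"
  have "((\<lambda>x. 1 / x) has_integral (ln 1 - ln (exp (- u)))) {exp (- u)..1}"
  proof (rule fundamental_theorem_of_calculus)
    fix x assume "x \<in> {exp (- u)..1}"
    then have "0 < x" using less_le_trans[OF exp_gt_zero, of "- u" x] by simp
    then show "(ln has_vector_derivative 1 / x) (at x within {exp (- u)..1})"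
      by (auto intro!: derivative_eq_intros simp: has_real_derivative_iff_has_vector_derivative[symmetric] field_simps)
  qed (use u in simp)
  then have "u = integral {exp (- u)..1} (\<lambda>x. 1 / x)"
    and int: "(\<lambda>x. 1 / x) integrable_on {exp (- u)..1}"
    by (auto simp: integral_unique has_integral_integrable)
  note this(1)
  also have "integral {exp (- u)..1} (\<lambda>x. 1 / x) \<le> passage_time (exp (- u))"
    unfolding passage_time_def
  proof (intro integral_le int integrable_continuous_real continuous_inverse_g)
    fix x assume "x \<in> {exp (- u)..1}"
    then have "0 < x" "x \<le> 1" using less_le_trans[OF exp_gt_zero, of "- u" x] by simp_all
    then show "1 / x \<le> 1 / g x" using pos[of x] le_self[of x] by (intro divide_left_mono) auto
  qed simp
  finally show ?thesis .
qed

lemma passage_time_surj: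
  assumes "0 \<le> u"
  shows "\<exists>x. 0 < x \<and> x \<le> 1 \<and> passage_time x = u"
proof -
  have "\<exists>x\<ge>exp (- u). x \<le> 1 \<and> passage_time x = u"
  proof (rule IVT2')
    show "continuous_on {exp (- u)..1} passage_time"
      using passage_time_deriv[of "exp (- u)"] by (intro DERIV_continuous_on) auto
  qed (use assms passage_time_exp[OF assms] in \<open>auto simp: passage_time_def\<close>)
  then show ?thesis using exp_gt_zero[of "- u"] by (metis less_le_trans)
qed

theorem passage_time_even_limit:
  assumes "u \<in> {0..1}"
  shows "passage_time (even_limit u) = u"
proof -
  have range: "even_limit r \<in> {exp (- 1)..1}" if "r \<in> {0..1}" for r
    using even_limit_ge_exp[OF that] limits_in_unit(1)[OF that] that
    by (auto intro: order_trans[of "exp (- 1)" "exp (- r)"])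
  have "\<exists>c. \<forall>u\<in>{0..1}. passage_time (even_limit u) - u = c"
  proof (rule has_field_derivative_zero_constant)
    fix u :: real assume u: "u \<in> {0..1}"
    have "(passage_time has_real_derivative - (1 / g (even_limit u))) (at (even_limit u) within even_limit ` {0..1})"
      by (rule DERIV_subset[OF passage_time_deriv[OF _ range[OF u]]]) (use range in auto)
    from DERIV_image_chain[OF this even_limit_deriv[OF u]]
    have "((\<lambda>u. passage_time (even_limit u)) has_real_derivative
        - (1 / g (even_limit u)) * - g (even_limit u)) (at u within {0..1})"
      by (simp add: o_def)
    moreover have "- (1 / g (even_limit u)) * - g (even_limit u) = 1"
      using pos[of "even_limit u"] range[OF u] less_le_trans[OF exp_gt_zero, of "- 1" "even_limit u"]
      by simp
    ultimately show "((\<lambda>u. passage_time (even_limit u) - u) has_real_derivative 0) (at u within {0..1})"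
      using DERIV_diff[OF _ DERIV_ident] by fastforce
  qed simp
  then obtain c where c: "\<And>u. u \<in> {0..1} \<Longrightarrow> passage_time (even_limit u) - u = c" by blast
  have "c = 0" using c[of 0] by (simp add: even_limit_0 passage_time_def)
  then show ?thesis using c[OF assms] by simp
qed

text \<open>
  Along the solution, \<open>q g(q) = - q q'\<close> is the derivative of \<open>- q\<^sup>2 / 2\<close>. This is the
  origin of the closed form for the root.
\<close>

lemma integral_self_times_g:
  assumes "u \<in> {0..1}"
  shows "integral {0..u} (\<lambda>r. even_limit r * g (even_limit r)) = (1 - (even_limit u)\<^sup>2) / 2"
proof -
  have "((\<lambda>r. even_limit r * g (even_limit r)) has_integral
      (- (even_limit u)\<^sup>2 / 2) - (- (even_limit 0)\<^sup>2 / 2)) {0..u}"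
  proof (rule fundamental_theorem_of_calculus)
    fix x assume "x \<in> {0..u}"
    then have x: "x \<in> {0..1}" using assms by auto
    have "((\<lambda>u. - (even_limit u)\<^sup>2 / 2) has_real_derivative even_limit x * g (even_limit x)) (at x within {0..1})"
      using even_limit_deriv[OF x] by (auto intro!: derivative_eq_intros)
    then have "((\<lambda>u. - (even_limit u)\<^sup>2 / 2) has_real_derivative even_limit x * g (even_limit x)) (at x within {0..u})"
      by (rule DERIV_subset) (use assms in auto)
    then show "((\<lambda>u. - (even_limit u)\<^sup>2 / 2) has_vector_derivative even_limit x * g (even_limit x)) (at x within {0..u})"
      by (simp add: has_real_derivative_iff_has_vector_derivative)
  qed (use assms in simp)
  then show ?thesis by (simp add: integral_unique even_limit_0 diff_divide_distrib)
qed

end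


section \<open>Averaging over the tree\<close>

text \<open>
  The law of the tree before completion; the independence and product measure arguments live here.
\<close>

definition degree_law :: "nat pmf \<Rightarrow> (nat list \<Rightarrow> nat) measure" where
  "degree_law a = PiM UNIV (\<lambda>_. measure_pmf a)"

text \<open>
  For \<open>d = 0\<close> this is the generating function \<open>G\<close> of the degree, which is the
  number of children of the root; for \<open>d = 1\<close> it is \<open>G(s) / s\<close>, the generating
  function of the number of children of any other vertex.
\<close>

definition degree_gf :: "nat pmf \<Rightarrow> nat \<Rightarrow> real \<Rightarrow> real" where
  "degree_gf a d s = measure_pmf.expectation a (\<lambda>k. s ^ (k - d))"

lemma degree_gf_sums:
  assumes "0 \<le> s" "s \<le> 1"
  shows "(\<lambda>k. pmf a k * s ^ (k - d)) sums degree_gf a d s"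
proof -
  have "integrable (count_space UNIV) (\<lambda>k. pmf a k * s ^ (k - d))"
    using assms by (intro Bochner_Integration.integrable_bound[OF integrable_pmf[of UNIV a]])
       (auto simp: abs_mult power_abs intro!: mult_left_le power_le_one)
  from sums_integral_count_space_nat[OF this] show ?thesis
    by (simp add: degree_gf_def measure_pmf_eq_density integral_density)
qed

abbreviation empty_vacancy :: "nat \<Rightarrow> (nat list \<Rightarrow> nat) \<Rightarrow> nat list \<Rightarrow> real \<Rightarrow> real" where
  "empty_vacancy n D i u \<equiv> vacancy n D i u (\<lambda>_. False)"

interpretation degree_law: prob_space "degree_law a" for a
  unfolding degree_law_def by (intro prob_space_PiM prob_space_measure_pmf)

lemma space_degree_law [simp]: "space (degree_law a) = UNIV"
  by (simp add: degree_law_def space_PiM)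

lemma measurable_degree [measurable]: "(\<lambda>D. D i) \<in> degree_law a \<rightarrow>\<^sub>M count_space UNIV"
proof -
  have "(\<lambda>D. D i) \<in> degree_law a \<rightarrow>\<^sub>M measure_pmf a"
    unfolding degree_law_def by (rule measurable_component_singleton) simp
  then show ?thesis by (simp add: measurable_pmf_measure2)
qed

lemma num_children_eq: "num_children D i = D i - (if i = [] then 0 else 1)"
  by (simp add: num_children_def)

lemma measurable_num_children [measurable]:
  "(\<lambda>D. num_children D i) \<in> degree_law a \<rightarrow>\<^sub>M count_space UNIV"
  unfolding num_children_eq by measurable

lemma distr_degree: "distr (degree_law a) (measure_pmf a) (\<lambda>D. D i) = measure_pmf a"
  unfolding degree_law_def by (rule distr_PiM_component) (auto intro: prob_space_measure_pmf)

lemma indep_degrees: "degree_law.indep_vars a (\<lambda>_. measure_pmf a) (\<lambda>i D. D i) UNIV"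
proof (subst degree_law.indep_vars_iff_distr_eq_PiM)
  show "(\<lambda>D. D i) \<in> degree_law a \<rightarrow>\<^sub>M measure_pmf a" for i
    unfolding degree_law_def by (rule measurable_component_singleton) simp
  have "distr (degree_law a) (PiM UNIV (\<lambda>_. measure_pmf a)) (\<lambda>D. \<lambda>i\<in>UNIV. D i) = degree_law a"
    using distr_id2[of "degree_law a" "PiM UNIV (\<lambda>_. measure_pmf a)"]
    by (simp add: degree_law_def restrict_def)
  then show "distr (degree_law a) (PiM UNIV (\<lambda>_. measure_pmf a)) (\<lambda>D. \<lambda>i\<in>UNIV. D i)
      = PiM UNIV (\<lambda>i. distr (degree_law a) (measure_pmf a) (\<lambda>D. D i))"
    by (simp add: distr_degree) (simp add: degree_law_def)
qed simp

text \<open>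
  The truncated vacancy probability at \<open>i\<close> reads the tree below \<open>i\<close> only, which is
  what makes those of siblings independent.
\<close>

lemma vacancy_cong_degrees:
  assumes "\<And>y. D (i @ y) = D' (i @ y)"
  shows "vacancy n D i u m = vacancy n D' i u m"
  using assms
proof (induction n arbitrary: i u)
  case (Suc n)
  have "vacancy n D (i @ [x]) r m = vacancy n D' (i @ [x]) r m" for x r
    using Suc.prems[of "x # _"] by (intro Suc.IH) simp
  moreover have "num_children D i = num_children D' i"
    using Suc.prems[of "[]"] by (simp add: num_children_eq)
  ultimately show ?case by simp
qed simp

text \<open>
  The branching property: a product over the children of \<open>i\<close> of functionals of their
  disjoint subtrees, all with the same mean \<open>s\<close>, has as its mean the generating function of the
  number of children at \<open>s\<close>. The number of factors is random and is separated by summing over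
  the value \<open>k\<close> of the degree of \<open>i\<close>, which is independent of the subtrees.
\<close>

theorem expectation_prod_children:
  fixes f :: "nat list \<Rightarrow> (nat list \<Rightarrow> nat) \<Rightarrow> real"
  assumes [measurable]: "\<And>j. f j \<in> borel_measurable (degree_law a)"
    and subtree: "\<And>j D D'. (\<And>y. D (j @ y) = D' (j @ y)) \<Longrightarrow> f j D = f j D'"
    and bounds: "\<And>j D. 0 \<le> f j D \<and> f j D \<le> 1"
    and mean: "\<And>x. (\<integral>D. f (i @ [x]) D \<partial>degree_law a) = s"
  shows "(\<integral>D. (\<Prod>x<num_children D i. f (i @ [x]) D) \<partial>degree_law a)
    = degree_gf a (if i = [] then 0 else 1) s"
proof -
  let ?M = "degree_law a"
  let ?d = "if i = [] then 0 else 1 :: nat"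
  have s: "0 \<le> s" "s \<le> 1"
  proof -
    have "integrable ?M (f (i @ [0]))"
      using bounds by (intro degree_law.integrable_const_bound[where B=1]) auto
    then show "0 \<le> s" "s \<le> 1"
      using bounds degree_law.integral_le_const[of a "f (i @ [0])" 1]
        Bochner_Integration.integral_nonneg[of ?M "f (i @ [0])"] mean[of 0] by auto
  qed
  have fixed: "(\<integral>D. indicator {D. D i = k} D * (\<Prod>x<k - ?d. f (i @ [x]) D) \<partial>?M)
      = pmf a k * s ^ (k - ?d)" for k
  proof -
    define c where "c = k - ?d"
    \<comment> \<open>Index \<open>0\<close> is the degree of \<open>i\<close>, index \<open>Suc x\<close> the subtree at the child \<open>x\<close>. Degrees outside a block
      are filled in with \<open>0\<close>, which the functional of that block does not see.\<close>
    define K where "K l = (case l of 0 \<Rightarrow> {i} | Suc x \<Rightarrow> {j. \<exists>y. j = i @ x # y})" for l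
    define ext where "ext l \<omega> = (\<lambda>j. if j \<in> K l then \<omega> j else 0 :: nat)" for l \<omega>
    define Y where "Y l \<omega> = (case l of 0 \<Rightarrow> of_bool (\<omega> i = k) | Suc x \<Rightarrow> f (i @ [x]) (ext l \<omega>))"
      for l and \<omega> :: "nat list \<Rightarrow> nat"
    have ext: "ext l \<in> PiM (K l) (\<lambda>_. measure_pmf a) \<rightarrow>\<^sub>M degree_law a" for l
      unfolding degree_law_def ext_def[abs_def]
    proof (rule measurable_PiM_single')
      show "(\<lambda>\<omega>. if j \<in> K l then \<omega> j else 0) \<in> PiM (K l) (\<lambda>_. measure_pmf a) \<rightarrow>\<^sub>M measure_pmf a" for j
        using measurable_component_singleton[of j "K l" "\<lambda>_. measure_pmf a"]
        by (cases "j \<in> K l") auto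
    qed auto
    have "degree_law.indep_vars a (\<lambda>l. PiM (K l) (\<lambda>_. measure_pmf a))
        (\<lambda>l D. restrict (\<lambda>j. D j) (K l)) {..c}"
      by (rule degree_law.indep_vars_restrict[OF indep_degrees])
         (auto simp: disjoint_family_on_def K_def split: nat.splits)
    moreover have "Y l \<in> PiM (K l) (\<lambda>_. measure_pmf a) \<rightarrow>\<^sub>M borel" for l
    proof (cases l)
      case 0
      have "(\<lambda>\<omega>. \<omega> i) \<in> PiM {i} (\<lambda>_. measure_pmf a) \<rightarrow>\<^sub>M measure_pmf a"
        by (rule measurable_component_singleton) simp
      then have [measurable]: "(\<lambda>\<omega>. \<omega> i) \<in> PiM {i} (\<lambda>_. measure_pmf a) \<rightarrow>\<^sub>M count_space UNIV"
        by (simp add: measurable_pmf_measure2)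
      show ?thesis unfolding 0 Y_def[abs_def] K_def by simp
    next
      case (Suc x)
      show ?thesis
        unfolding Y_def[abs_def] Suc using measurable_compose[OF ext[of l], of "f (i @ [x])" borel]
        by (simp add: Suc)
    qed
    ultimately have "degree_law.indep_vars a (\<lambda>_. borel) (\<lambda>l D. Y l (restrict (\<lambda>j. D j) (K l))) {..c}"
      by (rule degree_law.indep_vars_compose2)
    moreover have Y: "Y l (restrict (\<lambda>j. D j) (K l)) = (case l of 0 \<Rightarrow> of_bool (D i = k) | Suc x \<Rightarrow> f (i @ [x]) D)"
      for l D
    proof (cases l)
      case (Suc x)
      have "f (i @ [x]) (ext l (restrict (\<lambda>j. D j) (K l))) = f (i @ [x]) D"
        by (rule subtree) (simp add: ext_def K_def Suc)
      then show ?thesis by (simp add: Y_def Suc)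
    qed (simp add: Y_def K_def)
    ultimately have indep: "degree_law.indep_vars a (\<lambda>_. borel)
        (\<lambda>l D. case l of 0 \<Rightarrow> of_bool (D i = k) | Suc x \<Rightarrow> f (i @ [x]) D) {..c}"
      by (simp only:)
    have int: "integrable ?M (\<lambda>D. case l of 0 \<Rightarrow> of_bool (D i = k) | Suc x \<Rightarrow> f (i @ [x]) D)" for l
      using bounds by (cases l) (auto intro!: degree_law.integrable_const_bound[where B=1])
    have "(\<integral>D. (\<Prod>l\<in>{..c}. case l of 0 \<Rightarrow> of_bool (D i = k) | Suc x \<Rightarrow> f (i @ [x]) D) \<partial>?M)
        = (\<Prod>l\<in>{..c}. \<integral>D. (case l of 0 \<Rightarrow> of_bool (D i = k) | Suc x \<Rightarrow> f (i @ [x]) D) \<partial>?M)"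
      using int by (intro degree_law.indep_vars_lebesgue_integral indep) auto
    then have "(\<integral>D. of_bool (D i = k) * (\<Prod>x<c. f (i @ [x]) D) \<partial>?M)
        = (\<integral>D. of_bool (D i = k) \<partial>?M) * s ^ c"
      by (simp add: prod.atMost_shift mean)
    moreover have "(\<integral>D. of_bool (D i = k) \<partial>?M) = pmf a k"
    proof -
      have "(\<integral>D. of_bool (D i = k) \<partial>?M) = (\<integral>D. (indicator {k} (D i) :: real) \<partial>?M)"
        by (intro Bochner_Integration.integral_cong) (auto simp: indicator_def)
      also have "\<dots> = (\<integral>l. indicator {k} l \<partial>distr ?M (measure_pmf a) (\<lambda>D. D i))"
        by (rule integral_distr[symmetric]) (simp_all add: measurable_degree)
      also have "\<dots> = pmf a k"
        by (simp add: distr_degree pmf.rep_eq)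
      finally show ?thesis .
    qed
    ultimately show ?thesis
      by (simp add: c_def indicator_def of_bool_def)
  qed
  let ?F = "\<lambda>k D. indicator {D. D i = k} D * (\<Prod>x<k - ?d. f (i @ [x]) D)"
  have F: "0 \<le> ?F k D" "?F k D \<le> indicator {D. D i = k} D" for k D
    using bounds by (auto simp: indicator_def intro!: prod_nonneg prod_le_1)
  have F_sums: "(\<lambda>k. ?F k D) sums (\<Prod>x<num_children D i. f (i @ [x]) D)" for D
  proof -
    have "(\<lambda>k. ?F k D) = (\<lambda>k. if k = D i then \<Prod>x<k - ?d. f (i @ [x]) D else 0)"
      by (intro ext) (simp add: indicator_def)
    then show ?thesis unfolding num_children_eq by (simp only:) (rule sums_single)
  qed
  have int_F: "integrable ?M (?F k)" for k
  proof (rule degree_law.integrable_const_bound[where B=1])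
    have "norm (?F k D) \<le> 1" for D
    proof -
      have "?F k D \<le> 1" using F(2)[of k D] by (rule order_trans) (simp add: indicator_def)
      then show ?thesis using F(1)[of k D] by (simp only: real_norm_def abs_of_nonneg)
    qed
    then show "AE D in ?M. norm (?F k D) \<le> 1" by (intro AE_I2)
  qed measurable
  have "(\<lambda>k. \<integral>D. ?F k D \<partial>?M) sums (\<integral>D. (\<Sum>k. ?F k D) \<partial>?M)"
  proof (rule sums_integral[OF int_F])
    show "AE D in ?M. summable (\<lambda>k. norm (?F k D))"
      using F(1) sums_summable[OF F_sums] by simp
    show "summable (\<lambda>k. \<integral>D. norm (?F k D) \<partial>?M)"
      using F(1) degree_gf_sums[OF s, of a ?d]
      by (simp only: fixed real_norm_def abs_of_nonneg sums_summable)
  qed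
  then have "(\<lambda>k. pmf a k * s ^ (k - ?d)) sums (\<integral>D. (\<Prod>x<num_children D i. f (i @ [x]) D) \<partial>?M)"
    by (simp only: fixed sums_unique[OF F_sums, symmetric])
  then show ?thesis by (rule sums_unique2[OF _ degree_gf_sums[OF s]])
qed

text \<open>
  Outside \<open>[0, 1]\<close> the recursion has neither bounds nor a meaning. Clamping the
  time variable gives a function that is jointly measurable on the whole line.
\<close>

definition unit_clamp :: "real \<Rightarrow> real" where
  "unit_clamp u = max 0 (min 1 u)"

lemma unit_clamp_in: "unit_clamp u \<in> {0..1}"
  by (simp add: unit_clamp_def)

lemma unit_clamp_id: "u \<in> {0..1} \<Longrightarrow> unit_clamp u = u"
  by (simp add: unit_clamp_def)

lemma empty_vacancy_Suc_eq_LBINT: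
  assumes "u \<in> {0..1}"
  shows "empty_vacancy (Suc n) D i u
    = 1 - (\<integral>r. indicator {0..u} r * (\<Prod>x<num_children D i. empty_vacancy n D (i @ [x]) (unit_clamp r)) \<partial>lborel)"
proof -
  let ?Q = "\<lambda>r. \<Prod>x<num_children D i. empty_vacancy n D (i @ [x]) r"
  have "set_integrable lborel {0..u} ?Q"
    using assms by (intro borel_integrable_atLeastAtMost' continuous_on_subset[OF continuous_prod_vacancy]) auto
  then have "integral {0..u} ?Q = (LINT r : {0..u} | lborel. ?Q r)"
    by (rule set_borel_integral_eq_integral(2)[symmetric])
  also have "\<dots> = (\<integral>r. indicator {0..u} r * (\<Prod>x<num_children D i. empty_vacancy n D (i @ [x]) (unit_clamp r)) \<partial>lborel)"
    unfolding set_lebesgue_integral_def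
    using assms by (intro Bochner_Integration.integral_cong) (auto simp: indicator_def unit_clamp_id)
  finally show ?thesis by simp
qed

lemma measurable_prod_num_children:
  fixes f :: "nat \<Rightarrow> 'p \<Rightarrow> real" and d :: "'p \<Rightarrow> nat"
  assumes [measurable]: "\<And>x. (\<lambda>p. f x p) \<in> borel_measurable M" "d \<in> M \<rightarrow>\<^sub>M count_space UNIV"
  shows "(\<lambda>p. \<Prod>x<d p. f x p) \<in> borel_measurable M"
  by (rule measurable_compose_countable[OF _ assms(2), where f="\<lambda>k p. \<Prod>x<k. f x p"]) measurable

text \<open>
  Joint measurability in tree and time, which both the recursion and Fubini's theorem need.
\<close>

lemma measurable_empty_vacancy:
  "(\<lambda>p. empty_vacancy n (fst p) i (unit_clamp (snd p))) \<in> borel_measurable (degree_law a \<Otimes>\<^sub>M borel)"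
proof (induction n arbitrary: i)
  case (Suc n)
  have [measurable]: "unit_clamp \<in> borel \<rightarrow>\<^sub>M borel"
    unfolding unit_clamp_def[abs_def] by measurable
  have "(\<lambda>q. empty_vacancy n (fst (fst q)) (i @ [x]) (unit_clamp (snd q)))
      \<in> borel_measurable ((degree_law a \<Otimes>\<^sub>M borel) \<Otimes>\<^sub>M lborel)" for x
    by (rule measurable_compose[OF _ Suc.IH[of "i @ [x]"],
          where f = "\<lambda>q. (fst (fst q), snd q)", simplified]) measurable
  then have "(\<lambda>q. \<Prod>x<num_children (fst (fst q)) i. empty_vacancy n (fst (fst q)) (i @ [x]) (unit_clamp (snd q)))
      \<in> borel_measurable ((degree_law a \<Otimes>\<^sub>M borel) \<Otimes>\<^sub>M lborel)"
    by (rule measurable_prod_num_children) measurable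
  then have [measurable]: "(\<lambda>(p, r). \<Prod>x<num_children (fst p) i. empty_vacancy n (fst p) (i @ [x]) (unit_clamp r))
      \<in> borel_measurable ((degree_law a \<Otimes>\<^sub>M borel) \<Otimes>\<^sub>M lborel)"
    by (simp add: case_prod_beta')
  have "(\<lambda>p. 1 - (\<integral>r. of_bool (0 \<le> r \<and> r \<le> unit_clamp (snd p)) *
        (\<Prod>x<num_children (fst p) i. empty_vacancy n (fst p) (i @ [x]) (unit_clamp r)) \<partial>lborel))
      \<in> borel_measurable (degree_law a \<Otimes>\<^sub>M borel)"
    by measurable
  also have "(\<lambda>p. 1 - (\<integral>r. of_bool (0 \<le> r \<and> r \<le> unit_clamp (snd p)) *
        (\<Prod>x<num_children (fst p) i. empty_vacancy n (fst p) (i @ [x]) (unit_clamp r)) \<partial>lborel))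
      = (\<lambda>p. empty_vacancy (Suc n) (fst p) i (unit_clamp (snd p)))"
    unfolding empty_vacancy_Suc_eq_LBINT[OF unit_clamp_in]
    by (simp only: indicator_def atLeastAtMost_iff of_bool_def)
  finally show ?case .
qed simp

lemma measurable_empty_vacancy_at:
  assumes "u \<in> {0..1}"
  shows "(\<lambda>D. empty_vacancy n D i u) \<in> borel_measurable (degree_law a)"
  using measurable_compose[OF measurable_Pair2'[of u borel] measurable_empty_vacancy[of n i a]] assms
  by (simp add: unit_clamp_id)

lemma integrable_empty_vacancy:
  assumes "u \<in> {0..1}"
  shows "integrable (degree_law a) (\<lambda>D. empty_vacancy n D i u)"
  using vacancy_bounds[OF assms] measurable_empty_vacancy_at[OF assms]
  by (intro degree_law.integrable_const_bound[where B=1]) auto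

text \<open>
  Averaging the recursion: Fubini's theorem moves the mean under the time integral, where the
  branching property evaluates it.
\<close>

lemma expectation_empty_vacancy_Suc:
  assumes u: "u \<in> {0..1}"
    and mean: "\<And>x r. r \<in> {0..1} \<Longrightarrow> (\<integral>D. empty_vacancy n D (i @ [x]) r \<partial>degree_law a) = e r"
    and cont: "continuous_on {0..1} (\<lambda>r. degree_gf a (if i = [] then 0 else 1) (e r))"
  shows "(\<integral>D. empty_vacancy (Suc n) D i u \<partial>degree_law a)
    = 1 - integral {0..u} (\<lambda>r. degree_gf a (if i = [] then 0 else 1) (e r))"
proof -
  let ?M = "degree_law a"
  let ?Q = "\<lambda>D r. \<Prod>x<num_children D i. empty_vacancy n D (i @ [x]) (unit_clamp r)"
  let ?f = "\<lambda>D r. indicator {0..u} r * ?Q D r"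
  let ?G = "\<lambda>r. degree_gf a (if i = [] then 0 else 1) (e r)"
  interpret pair_sigma_finite ?M lborel ..
  have Q: "0 \<le> ?Q D r" "?Q D r \<le> 1" for D r
    using vacancy_bounds[OF unit_clamp_in] by (auto intro!: prod_nonneg prod_le_1)
  have meas: "(\<lambda>p. ?Q (fst p) (snd p)) \<in> borel_measurable (?M \<Otimes>\<^sub>M lborel)"
    using measurable_empty_vacancy[of n _ a]
    by (intro measurable_prod_num_children) (simp_all cong: measurable_cong_sets sets_pair_measure_cong)
  have "integrable (?M \<Otimes>\<^sub>M lborel) (\<lambda>p. ?f (fst p) (snd p))"
  proof (rule integrableI_bounded_set[where A = "UNIV \<times> {0..u}" and B = 1])
    show "UNIV \<times> {0..u} \<in> sets (?M \<Otimes>\<^sub>M lborel)"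
      using sets.top[of ?M] by (intro pair_measureI) auto
    show "(\<lambda>p. ?f (fst p) (snd p)) \<in> borel_measurable (?M \<Otimes>\<^sub>M lborel)"
      using meas by measurable
    have "emeasure (?M \<Otimes>\<^sub>M lborel) (UNIV \<times> {0..u}) = emeasure ?M UNIV * emeasure lborel {0..u}"
      using sets.top[of ?M] by (intro lborel.emeasure_pair_measure_Times) auto
    then show "emeasure (?M \<Otimes>\<^sub>M lborel) (UNIV \<times> {0..u}) < \<infinity>"
      using degree_law.emeasure_space_1[of a] u by simp
    show "AE p in ?M \<Otimes>\<^sub>M lborel. p \<in> UNIV \<times> {0..u} \<longrightarrow> norm (?f (fst p) (snd p)) \<le> 1"
      using Q by (auto simp: indicator_def)
  qed (auto simp: indicator_def)
  then have int: "integrable (?M \<Otimes>\<^sub>M lborel) (case_prod ?f)"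
    by (simp add: case_prod_beta')
  have "integrable ?M (\<lambda>D. \<integral>r. ?f D r \<partial>lborel)"
    using integrable_fst[OF int] .
  then have "(\<integral>D. empty_vacancy (Suc n) D i u \<partial>?M) = 1 - (\<integral>D. (\<integral>r. ?f D r \<partial>lborel) \<partial>?M)"
    unfolding empty_vacancy_Suc_eq_LBINT[OF u] by (simp add: degree_law.prob_space[simplified])
  also have "(\<integral>D. (\<integral>r. ?f D r \<partial>lborel) \<partial>?M) = (\<integral>r. (\<integral>D. ?f D r \<partial>?M) \<partial>lborel)"
    by (rule Fubini_integral[OF int, symmetric])
  also have "\<dots> = (LINT r : {0..u} | lborel. ?G r)"
    unfolding set_lebesgue_integral_def
  proof (intro Bochner_Integration.integral_cong refl)
    fix r :: real
    show "(\<integral>D. ?f D r \<partial>?M) = indicator {0..u} r *\<^sub>R ?G r"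
    proof (cases "r \<in> {0..u}")
      case True
      then have r: "r \<in> {0..1}" using u by auto
      have "(\<integral>D. (\<Prod>x<num_children D i. empty_vacancy n D (i @ [x]) r) \<partial>?M) = ?G r"
        using measurable_empty_vacancy_at[OF r] vacancy_bounds[OF r] mean[OF r]
        by (intro expectation_prod_children vacancy_cong_degrees) auto
      then show ?thesis using True r by (simp add: unit_clamp_id)
    qed simp
  qed
  also have "\<dots> = integral {0..u} ?G"
    using u by (intro set_borel_integral_eq_integral(2) borel_integrable_atLeastAtMost'
        continuous_on_subset[OF cont]) auto
  finally show ?thesis .
qed


section \<open>The occupation probability of the root\<close>

(* Keeps the parameter of degree_gf a 1 syntactically equal to the one in antitone_flow. *)
declare One_nat_def [simp del]

lemma integrable_power_pmf: "0 \<le> s \<Longrightarrow> s \<le> 1 \<Longrightarrow> integrable (measure_pmf a) (\<lambda>k. s ^ f k :: real)"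
  by (intro measure_pmf.integrable_const_bound[where B=1]) (auto simp: power_le_one)

lemma degree_gf_mono:
  assumes "0 \<le> x" "x \<le> y" "y \<le> 1"
  shows "degree_gf a d x \<le> degree_gf a d y"
  unfolding degree_gf_def
  using assms by (intro integral_mono integrable_power_pmf power_mono) auto

lemma degree_gf_nonneg: "0 \<le> s \<Longrightarrow> 0 \<le> degree_gf a d s"
  unfolding degree_gf_def by (intro Bochner_Integration.integral_nonneg) simp

lemma degree_gf_pos:
  assumes "0 < s" "s \<le> 1"
  shows "0 < degree_gf a d s"
proof -
  have "degree_gf a d s \<noteq> 0"
  proof
    assume "degree_gf a d s = 0"
    then have "AE k in measure_pmf a. s ^ (k - d) = 0"
      unfolding degree_gf_def using assms
      by (subst (asm) integral_nonneg_eq_0_iff_AE) (auto intro: integrable_power_pmf)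
    then show False
      using assms(1) set_pmf_not_empty[of a] by (auto simp: AE_measure_pmf_iff)
  qed
  then show ?thesis using degree_gf_nonneg[of s a d] assms by simp
qed

lemma continuous_degree_gf: "continuous_on {0..1} (degree_gf a d)"
  unfolding continuous_on_sequentially
proof (intro allI ballI impI, elim conjE)
  fix x :: "nat \<Rightarrow> real" and s
  assume x: "\<forall>n. x n \<in> {0..1}" "x \<longlonglongrightarrow> s"
  show "(degree_gf a d \<circ> x) \<longlonglongrightarrow> degree_gf a d s"
    unfolding degree_gf_def o_def
    by (rule integral_dominated_convergence[where w="\<lambda>_. 1"])
       (use x in \<open>auto intro!: tendsto_power simp: power_abs power_le_one\<close>)
qed

lemma degree_gf_1_le:
  assumes "set_pmf a \<subseteq> {2..}" "0 \<le> s" "s \<le> 1"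
  shows "degree_gf a 1 s \<le> s"
proof -
  have "degree_gf a 1 s \<le> measure_pmf.expectation a (\<lambda>_. s)"
    unfolding degree_gf_def
  proof (intro integral_mono_AE integrable_power_pmf assms(2,3))
    show "AE k in measure_pmf a. s ^ (k - 1) \<le> s"
      using assms power_decreasing[of 1 _ s] by (force simp: AE_measure_pmf_iff)
  qed simp
  then show ?thesis by simp
qed

lemma degree_gf_0_eq:
  assumes "set_pmf a \<subseteq> {2..}"
  shows "degree_gf a 0 s = s * degree_gf a 1 s"
proof -
  have "degree_gf a 0 s = measure_pmf.expectation a (\<lambda>k. s * s ^ (k - 1))"
    unfolding degree_gf_def
  proof (intro integral_cong_AE)
    show "AE k in measure_pmf a. s ^ (k - 0) = s * s ^ (k - 1)"
      using assms by (force simp: AE_measure_pmf_iff power_eq_if)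
  qed simp_all
  then show ?thesis by (simp add: degree_gf_def)
qed

lemma gen_fun_eq_degree_gf: "0 \<le> s \<Longrightarrow> s \<le> 1 \<Longrightarrow> gen_fun a s = degree_gf a 0 s"
  unfolding gen_fun_def using sums_unique[OF degree_gf_sums[of s a 0]] by simp

lemma antitone_flow_degree_gf:
  assumes "set_pmf a \<subseteq> {2..}"
  shows "antitone_flow (degree_gf a 1)"
  by unfold_locales
     (use continuous_degree_gf degree_gf_mono degree_gf_nonneg degree_gf_pos degree_gf_1_le[OF assms] in auto)

lemma expectation_empty_vacancy:
  assumes "antitone_flow (degree_gf a 1)" "i \<noteq> []" "u \<in> {0..1}"
  shows "(\<integral>D. empty_vacancy n D i u \<partial>degree_law a) = picard (degree_gf a 1) n u"
  using assms(2,3)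
proof (induction n arbitrary: i u)
  case 0
  then show ?case by (simp add: degree_law.prob_space[simplified])
next
  case (Suc n)
  interpret antitone_flow "degree_gf a 1" by fact
  have "(\<integral>D. empty_vacancy (Suc n) D i u \<partial>degree_law a)
      = 1 - integral {0..u} (\<lambda>r. degree_gf a (if i = [] then 0 else 1) (picard (degree_gf a 1) n r))"
    using Suc.prems continuous_picard[of n] by (intro expectation_empty_vacancy_Suc Suc.IH) simp_all
  then show ?case using Suc.prems by simp
qed

text \<open>
  The root has one more child than a typical vertex, so its vacancy loses \<open>G(q) = q g(q)\<close>
  instead of \<open>g(q)\<close> per unit of \<open>u\<close>.
\<close>

lemma expectation_root_vacancy_tendsto:
  assumes a: "set_pmf a \<subseteq> {2..}" and u: "u \<in> {0..1}"
  defines "A \<equiv> antitone_flow.even_limit (degree_gf a 1)"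
  shows "(\<lambda>n. \<integral>D. empty_vacancy (2 * n + 1) D [] u \<partial>degree_law a) \<longlonglongrightarrow> 1 - (1 - (A u)\<^sup>2) / 2"
    "(\<lambda>n. \<integral>D. empty_vacancy (2 * n + 2) D [] u \<partial>degree_law a) \<longlonglongrightarrow> 1 - (1 - (A u)\<^sup>2) / 2"
proof -
  let ?p = "picard (degree_gf a 1)"
  interpret antitone_flow "degree_gf a 1" by (rule antitone_flow_degree_gf[OF a])
  have root: "(\<integral>D. empty_vacancy (Suc n) D [] u \<partial>degree_law a) = 1 - integral {0..u} (\<lambda>r. degree_gf a 0 (?p n r))" for n
  proof -
    have "continuous_on {0..1} (\<lambda>r. degree_gf a 0 (?p n r))"
      by (rule continuous_on_compose2[OF continuous_degree_gf picard_bounds_continuous(1)])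
         (use picard_bounds_continuous(2) in blast)
    then have "(\<integral>D. empty_vacancy (Suc n) D [] u \<partial>degree_law a)
        = 1 - integral {0..u} (\<lambda>r. degree_gf a (if [] = ([] :: nat list) then 0 else 1) (?p n r))"
      by (intro expectation_empty_vacancy_Suc u expectation_empty_vacancy antitone_flow_axioms) simp_all
    then show ?thesis by simp
  qed
  have "integral {0..u} (\<lambda>r. degree_gf a 0 (A r)) = (1 - (A u)\<^sup>2) / 2"
    using integral_self_times_g[OF u] by (simp add: A_def degree_gf_0_eq[OF a])
  then have lim: "(\<lambda>n. 1 - integral {0..u} (\<lambda>r. degree_gf a 0 (?p (f n) r))) \<longlonglongrightarrow> 1 - (1 - (A u)\<^sup>2) / 2"
    if "\<And>r. r \<in> {0..1} \<Longrightarrow> (\<lambda>n. ?p (f n) r) \<longlonglongrightarrow> A r" for f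
    using integral_limit(2)[OF continuous_degree_gf picard_bounds_continuous(2,1) that u, of a 0]
    by (intro tendsto_diff tendsto_const) (simp only:)
  have odd: "2 * n + 1 = Suc (2 * n)" and even: "2 * n + 2 = Suc (2 * n + 1)" for n :: nat
    by simp_all
  show "(\<lambda>n. \<integral>D. empty_vacancy (2 * n + 1) D [] u \<partial>degree_law a) \<longlonglongrightarrow> 1 - (1 - (A u)\<^sup>2) / 2"
    unfolding odd root by (rule lim) (simp only: A_def picard_tendsto(1))
  show "(\<lambda>n. \<integral>D. empty_vacancy (2 * n + 2) D [] u \<partial>degree_law a) \<longlonglongrightarrow> 1 - (1 - (A u)\<^sup>2) / 2"
    unfolding even root by (rule lim) (simp only: A_def picard_tendsto(2))
qed

lemma measurable_completion_AE_eq: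
  fixes f g :: "'a \<Rightarrow> real"
  assumes "g \<in> borel_measurable M" "AE x in completion M. f x = g x"
  shows "f \<in> borel_measurable (completion M)"
proof (rule measurableI)
  fix A :: "real set" assume A: "A \<in> sets borel"
  have "g \<in> borel_measurable (completion M)" by (rule measurable_completion[OF assms(1)])
  then have "g -` A \<inter> space (completion M) \<in> sets (completion M)" using A by (rule measurable_sets)
  then show "f -` A \<inter> space (completion M) \<in> sets (completion M)"
    by (rule completion.in_sets_AE[rotated]) (use assms(2) in auto)
qed simp

text \<open>
  The supremum of the lower bounds and the infimum of the upper bounds have the same mean, hence
  coincide almost surely, and the completion makes every function between them measurable. An
  occupation probability of an arbitrary family of processes acquires its measurability in the tree
  in this way.
\<close>

lemma (in prob_space) integral_completion_squeeze:
  fixes l h :: "nat \<Rightarrow> 'a \<Rightarrow> real"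
  assumes [measurable]: "\<And>n. l n \<in> borel_measurable M" "\<And>n. h n \<in> borel_measurable M"
    and l: "\<And>n x. l n x \<in> {0..1}" and h: "\<And>n x. h n x \<in> {0..1}"
    and F: "AE x in completion M. \<forall>n. l n x \<le> F x \<and> F x \<le> h n x"
    and lim: "(\<lambda>n. \<integral>x. l n x \<partial>M) \<longlonglongrightarrow> c" "(\<lambda>n. \<integral>x. h n x \<partial>M) \<longlonglongrightarrow> c"
  shows "(\<integral>x. F x \<partial>completion M) = c"
proof -
  define L where "L x = (SUP n. l n x)" for x
  define H where "H x = (INF n. h n x)" for x
  have bdd: "bdd_above (range (\<lambda>n. l n x))" "bdd_below (range (\<lambda>n. h n x))" for x
    using l h by (auto intro!: bdd_aboveI[of _ 1] bdd_belowI[of _ 0])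
  have meas [measurable]: "L \<in> borel_measurable M" "H \<in> borel_measurable M"
    unfolding L_def[abs_def] H_def[abs_def] using bdd by (auto intro!: borel_measurable_cSUP borel_measurable_cINF)
  have le: "l n x \<le> L x" "H x \<le> h n x" for n x
    unfolding L_def H_def using bdd by (auto intro: cSUP_upper cINF_lower)
  have LH: "L x \<in> {0..1}" "H x \<in> {0..1}" for x
  proof -
    have "L x \<le> 1" "0 \<le> H x"
      unfolding L_def H_def using l h by (auto intro!: cSUP_least cINF_greatest)
    then show "L x \<in> {0..1}" "H x \<in> {0..1}"
      using le(1)[of 0 x] le(2)[of x 0] l[of 0 x] h[of 0 x] by auto
  qed
  have int: "integrable M f" if "f \<in> borel_measurable M" "\<And>x. f x \<in> {0..1}" for f :: "'a \<Rightarrow> real"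
    using that by (intro integrable_const_bound[where B=1]) auto
  have sandwich: "AE x in completion M. L x \<le> F x \<and> F x \<le> H x"
    using F by eventually_elim (auto simp: L_def H_def intro!: cSUP_least cINF_greatest)
  then have "AE x in M. L x \<le> H x"
    unfolding AE_completion_iff by eventually_elim simp
  moreover have "(\<integral>x. H x - L x \<partial>M) = 0"
  proof (rule antisym)
    have "(\<integral>x. H x \<partial>M) \<le> c"
      by (rule LIMSEQ_le_const[OF lim(2)]) (intro exI allI impI integral_mono int meas LH h le; measurable)
    moreover have "c \<le> (\<integral>x. L x \<partial>M)"
      by (rule LIMSEQ_le_const2[OF lim(1)]) (intro exI allI impI integral_mono int meas LH l le; measurable)
    ultimately show "(\<integral>x. H x - L x \<partial>M) \<le> 0"
      using int[OF meas(1) LH(1)] int[OF meas(2) LH(2)] by simp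
    show "0 \<le> (\<integral>x. H x - L x \<partial>M)"
      using \<open>AE x in M. L x \<le> H x\<close> by (intro integral_nonneg_AE) auto
  qed
  ultimately have "AE x in M. H x - L x = 0"
    using int[OF meas(1) LH(1)] int[OF meas(2) LH(2)] by (subst (asm) integral_nonneg_eq_0_iff_AE) auto
  then have "AE x in completion M. H x - L x = 0" by (rule AE_completion)
  with sandwich have FH: "AE x in completion M. F x = H x" by eventually_elim auto
  have "(\<integral>x. F x \<partial>completion M) = (\<integral>x. H x \<partial>completion M)"
    by (intro integral_cong_AE measurable_completion_AE_eq[OF meas(2) FH] measurable_completion meas(2) FH)
  also have "\<dots> = (\<integral>x. H x \<partial>M)" by (rule integral_completion) (rule meas(2))
  also have "\<dots> = c"
  proof (rule antisym)
    show "(\<integral>x. H x \<partial>M) \<le> c"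
      by (rule LIMSEQ_le_const[OF lim(2)]) (intro exI allI impI integral_mono int meas LH h le; measurable)
    have "c \<le> (\<integral>x. L x \<partial>M)"
      by (rule LIMSEQ_le_const2[OF lim(1)]) (intro exI allI impI integral_mono int meas LH l le; measurable)
    also have "\<dots> \<le> (\<integral>x. H x \<partial>M)"
      using \<open>AE x in M. L x \<le> H x\<close> by (intro integral_mono_AE int meas LH)
    finally show "c \<le> (\<integral>x. H x \<partial>M)" .
  qed
  finally show ?thesis .
qed

theorem mean_occupation_eq:
  assumes a: "set_pmf a \<subseteq> {2..}"
    and P: "AE D in tree_law a. parking_process (tree_vertices D) (tree_edges D) (P D)"
    and t: "0 \<le> t"
  shows "mean_occupation a P t = (1 - (antitone_flow.even_limit (degree_gf a 1) (1 - exp (- t)))\<^sup>2) / 2"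
proof -
  let ?u = "1 - exp (- t)" and ?A = "antitone_flow.even_limit (degree_gf a 1)"
  let ?v = "\<lambda>n D. 1 - empty_vacancy n D [] ?u"
  have u: "?u \<in> {0..1}" using t by simp
  have law: "tree_law a = completion (degree_law a)" by (simp add: tree_law_def degree_law_def)
  have lim: "(\<lambda>n. \<integral>D. ?v (2 * n + d) D \<partial>degree_law a) \<longlonglongrightarrow> 1 - (1 - (1 - (?A ?u)\<^sup>2) / 2)"
    if "(\<lambda>n. \<integral>D. empty_vacancy (2 * n + d) D [] ?u \<partial>degree_law a) \<longlonglongrightarrow> 1 - (1 - (?A ?u)\<^sup>2) / 2" for d
    using tendsto_diff[OF tendsto_const that, of 1] integrable_empty_vacancy[OF u]
    by (simp add: degree_law.prob_space[simplified] del: vacancy.simps)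
  \<comment> \<open>Passing from vacancy to occupation exchanges the two bounds: even depths now bound from below.\<close>
  have "(\<integral>D. (\<integral>n. of_bool (n []) \<partial>P D t (empty_config (tree_vertices D))) \<partial>completion (degree_law a))
      = 1 - (1 - (1 - (?A ?u)\<^sup>2) / 2)"
  proof (rule degree_law.integral_completion_squeeze[where l = "\<lambda>n. ?v (2 * n + 2)" and h = "\<lambda>n. ?v (2 * n + 1)"])
    show "AE D in completion (degree_law a). \<forall>n.
        ?v (2 * n + 2) D \<le> (\<integral>n. of_bool (n []) \<partial>P D t (empty_config (tree_vertices D))) \<and>
        (\<integral>n. of_bool (n []) \<partial>P D t (empty_config (tree_vertices D))) \<le> ?v (2 * n + 1) D"
      using P unfolding law
    proof eventually_elim
      case (elim D)
      show ?case
      proof (intro allI conjI)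
        fix n
        show "?v (2 * n + 2) D \<le> (\<integral>n. of_bool (n []) \<partial>P D t (empty_config (tree_vertices D)))"
          using root_vacancy_bracket[OF elim t, of "2 * n + 2"] by (simp del: vacancy.simps)
        show "(\<integral>n. of_bool (n []) \<partial>P D t (empty_config (tree_vertices D))) \<le> ?v (2 * n + 1) D"
          using root_vacancy_bracket[OF elim t, of "2 * n + 1"] by (simp del: vacancy.simps)
      qed
    qed
    show "(\<lambda>n. \<integral>D. ?v (2 * n + 2) D \<partial>degree_law a) \<longlonglongrightarrow> 1 - (1 - (1 - (?A ?u)\<^sup>2) / 2)"
      by (rule lim[OF expectation_root_vacancy_tendsto(2)[OF a u]])
    show "(\<lambda>n. \<integral>D. ?v (2 * n + 1) D \<partial>degree_law a) \<longlonglongrightarrow> 1 - (1 - (1 - (?A ?u)\<^sup>2) / 2)"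
      by (rule lim[OF expectation_root_vacancy_tendsto(1)[OF a u]])
  qed (use measurable_empty_vacancy_at[OF u] vacancy_bounds[OF u] in \<open>simp_all del: vacancy.simps\<close>)
  then show ?thesis by (simp add: mean_occupation_def law)
qed

text \<open>
  The equation that defines \<open>\<alpha>\<close> asks for the level that the solution reaches at time \<open>u\<close>.
\<close>

lemma alpha_eq_iff:
  assumes a: "set_pmf a \<subseteq> {2..}" and x: "0 < x" "x \<le> 1"
  shows "alpha_eq a u x \<longleftrightarrow> antitone_flow.passage_time (degree_gf a 1) x = u"
proof -
  interpret antitone_flow "degree_gf a 1" by (rule antitone_flow_degree_gf[OF a])
  have "alpha_eq a u x \<longleftrightarrow> ((\<lambda>y. 1 / degree_gf a 1 y) has_integral u) {x..1}"
    unfolding alpha_eq_def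
  proof (rule has_integral_cong)
    fix y assume "y \<in> {x..1}"
    then show "y / gen_fun a y = 1 / degree_gf a 1 y"
      using x by (simp add: gen_fun_eq_degree_gf degree_gf_0_eq[OF a])
  qed
  also have "\<dots> \<longleftrightarrow> passage_time x = u"
    unfolding passage_time_def
    using integrable_continuous_real[OF continuous_inverse_g[OF x(1)]] by (auto simp: has_integral_iff)
  finally show ?thesis .
qed

theorem theorem1:
  fixes a :: "nat pmf"
    and P :: "(nat list \<Rightarrow> nat) \<Rightarrow> real \<Rightarrow> (nat list \<Rightarrow> bool) \<Rightarrow> (nat list \<Rightarrow> bool) measure"
  assumes "set_pmf a \<subseteq> {2..}"
    and "AE D in tree_law a. parking_process (tree_vertices D) (tree_edges D) (P D)"
  shows "(\<forall>u\<ge>0. \<exists>!\<alpha>. 0 < \<alpha> \<and> \<alpha> \<le> 1 \<and> alpha_eq a u \<alpha>) \<and>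
    (\<forall>t\<ge>0. mean_occupation a P t = (1 - (alpha a (1 - exp (- t)))\<^sup>2) / 2) \<and>
    (\<exists>!\<alpha>. 0 < \<alpha> \<and> \<alpha> < 1 \<and> alpha_eq a 1 \<alpha>) \<and>
    (\<forall>\<alpha>. 0 < \<alpha> \<and> \<alpha> < 1 \<and> alpha_eq a 1 \<alpha> \<longrightarrow>
      (mean_occupation a P \<longlongrightarrow> (1 - \<alpha>\<^sup>2) / 2) at_top)"
proof -
  interpret antitone_flow "degree_gf a 1" by (rule antitone_flow_degree_gf[OF assms(1)])
  have alpha_eq: "0 < x \<and> x \<le> 1 \<and> alpha_eq a u x \<longleftrightarrow> 0 < x \<and> x \<le> 1 \<and> passage_time x = u" for x u
    using alpha_eq_iff[OF assms(1)] by blast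
  have unique: "\<exists>!x. 0 < x \<and> x \<le> 1 \<and> alpha_eq a u x" if "0 \<le> u" for u
    unfolding alpha_eq using passage_time_surj[OF that] passage_time_inj by blast
  have limit: "0 < even_limit u \<and> even_limit u \<le> 1 \<and> alpha_eq a u (even_limit u)" if "u \<in> {0..1}" for u
    unfolding alpha_eq
    using passage_time_even_limit[OF that] limits_in_unit(1)[OF that]
      less_le_trans[OF exp_gt_zero even_limit_ge_exp[OF that]] by simp
  have alpha: "alpha a u = even_limit u" if "u \<in> {0..1}" for u
    unfolding alpha_def using that by (intro the1_equality unique limit) simp
  have lt_1: "x < 1 \<longleftrightarrow> x \<le> 1" if "alpha_eq a 1 x" for x
  proof -
    have "\<not> alpha_eq a 1 1" using alpha_eq[of 1 1] by (simp add: passage_time_def)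
    then show ?thesis using that by (cases "x = 1") auto
  qed
  have unique_1: "\<exists>!x. 0 < x \<and> x < 1 \<and> alpha_eq a 1 x"
    using unique[of 1] lt_1 by (metis zero_le_one)
  have occupation: "mean_occupation a P t = (1 - (even_limit (1 - exp (- t)))\<^sup>2) / 2" if "0 \<le> t" for t
    by (rule mean_occupation_eq[OF assms that])
  have "(mean_occupation a P \<longlongrightarrow> (1 - x\<^sup>2) / 2) at_top"
    if "0 < x \<and> x < 1 \<and> alpha_eq a 1 x" for x
  proof -
    have "x = even_limit 1"
      using unique[of 1] limit[of 1] that by (metis atLeastAtMost_iff less_imp_le order_refl zero_le_one)
    moreover have "((\<lambda>t. even_limit (1 - exp (- t))) \<longlongrightarrow> even_limit 1) at_top"
    proof (rule continuous_on_tendsto_compose[OF continuous_limits(1)])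
      have "((\<lambda>t::real. exp (- t)) \<longlongrightarrow> 0) at_top"
        by (rule filterlim_compose[OF exp_at_bot filterlim_uminus_at_bot_at_top])
      from tendsto_diff[OF tendsto_const this, of 1]
      show "((\<lambda>t::real. 1 - exp (- t)) \<longlongrightarrow> 1) at_top" by simp
      show "\<forall>\<^sub>F t in at_top. 1 - exp (- t) \<in> {0..1::real}"
        using eventually_ge_at_top[of 0] by eventually_elim simp
    qed simp
    ultimately have "((\<lambda>t. (1 - (even_limit (1 - exp (- t)))\<^sup>2) / 2) \<longlongrightarrow> (1 - x\<^sup>2) / 2) at_top"
      by (auto intro!: tendsto_intros)
    then show ?thesis
      by (rule Lim_transform_eventually)
         (use eventually_ge_at_top[of 0] in eventually_elim, simp add: occupation)
  qed
  then show ?thesis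
    using unique unique_1 occupation alpha by auto
qed

end
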